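(* Let $\Omega\subset\mathbb{R}^d$ be compact with probability measure $\mu$, let $2\le p<\infty$, $\beta\in(0,1]$, $r>0$, and let $\Psi=\{\psi_{\mathbf k}\}_{\mathbf k\in\mathbb{Z}^d}\subset\mathcal{C}(\Omega)$ be a uniformly bounded Bessel system with constant $K>0$. There exist constants $c=c(r,\beta,p,K,d)$ and $C=C(r,\beta,p,d)$ such that for every $v\in\mathbb{N}$: if $\Psi\in NI(2,p,H,2v)$, then $$\varrho_m^o(\mathbf{A}^r_\beta(\Psi),L_p(\Omega,\mu))\le CH\,v^{1/2-1/\beta-r/d}$$ for every $m\ge c\,v(\log(2v))^4$.
   Context: Uniformly bounded Bessel system: $\sup_{x\in\Omega}|\psi_{\mathbf k}(x)|\le1$ for all $\mathbf k$, and for every finite $Q\subset\mathbb{Z}^d$ and $(a_{\mathbf k})_{\mathbf k\in Q}\subset\mathbb{C}$: $\sum_Q|a_{\mathbf k}|^2\le K\|\sum_Q a_{\mathbf k}\psi_{\mathbf k}\|_{L_2(\Omega,\mu)}^2$. $\Psi\in NI(2,p,H,u)$ means $\|f\|_{L_p(\Omega,\mu)}\le H\|f\|_{L_2(\Omega,\mu)}$ for every linear combination $f$ of at most $u$ elements of $\Psi$. Class $\mathbf{A}^r_\beta(\Psi)$: all $f=\sum_{\mathbf k\in\mathbb{Z}^d}a_{\mathbf k}(f)\psi_{\mathbf k}$ with $\sum_{\mathbf k}|a_{\mathbf k}(f)|<\infty$ and $\big(\sum_{[2^{j-1}]\le\|\mathbf k\|_\infty<2^j}|a_{\mathbf k}(f)|^\beta\big)^{1/\beta}\le2^{-rj}$,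 $j=0,1,\dots$. $\varrho_m^o(\mathbf F,L_p)=\inf_\xi\inf_{\mathcal M}\sup_{f\in\mathbf F}\|f-\mathcal M(f(\xi^1),\dots,f(\xi^m))\|_{L_p(\Omega,\mu)}$, infima over all $m$-point sets $\xi\subset\Omega$ and all mappings $\mathcal M:\mathbb{C}^m\to L_p(\Omega,\mu)$. *)

theory Defs
  imports "HOL-Probability.Probability"
begin

definition Lp_norm :: "'a measure \<Rightarrow> real \<Rightarrow> ('a \<Rightarrow> complex) \<Rightarrow> real" where
  "Lp_norm \<mu> p f = (\<integral>x. (norm (f x)) powr p \<partial>\<mu>) powr (1 / p)"

definition in_Lp :: "'a measure \<Rightarrow> real \<Rightarrow> ('a \<Rightarrow> complex) \<Rightarrow> bool" where
  "in_Lp \<mu> p g \<longleftrightarrow> g \<in> borel_measurable \<mu> \<and> integrable \<mu> (\<lambda>x. (norm (g x)) powr p)"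

definition linf_int :: "int ^ 'd \<Rightarrow> int" where
  "linf_int k = Max (range (\<lambda>i. \<bar>k $ i\<bar>))"

text \<open>Dyadic block  [2^(j-1)] <= ||k||_inf < 2^j  (with [1/2] = 0).\<close>
definition dyadic_block :: "nat \<Rightarrow> (int ^ 'd) set" where
  "dyadic_block j = {k. (2::int) ^ j div 2 \<le> linf_int k \<and> linf_int k < 2 ^ j}"

definition unif_bounded_Bessel ::
  "(real ^ 'd) set \<Rightarrow> (real ^ 'd) measure \<Rightarrow> (int ^ 'd \<Rightarrow> real ^ 'd \<Rightarrow> complex) \<Rightarrow> real \<Rightarrow> bool" where
  "unif_bounded_Bessel \<Omega> \<mu> \<psi> K \<longleftrightarrow>
     (\<forall>k. \<forall>x\<in>\<Omega>. norm (\<psi> k x) \<le> 1) \<and>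
     (\<forall>Q a. finite Q \<longrightarrow>
        (\<Sum>k\<in>Q. (norm (a k))\<^sup>2) \<le> K * (\<integral>x. (norm (\<Sum>k\<in>Q. a k * \<psi> k x))\<^sup>2 \<partial>\<mu>))"

definition NI :: "(real ^ 'd) measure \<Rightarrow> (int ^ 'd \<Rightarrow> real ^ 'd \<Rightarrow> complex) \<Rightarrow> real \<Rightarrow> real \<Rightarrow> nat \<Rightarrow> bool" where
  "NI \<mu> \<psi> p H u \<longleftrightarrow>
     (\<forall>Q a. finite Q \<and> card Q \<le> u \<longrightarrow>
        Lp_norm \<mu> p (\<lambda>x. \<Sum>k\<in>Q. a k * \<psi> k x) \<le> H * Lp_norm \<mu> 2 (\<lambda>x. \<Sum>k\<in>Q. a k * \<psi> k x))"

definition A_class :: "(int ^ 'd \<Rightarrow> real ^ 'd \<Rightarrow> complex) \<Rightarrow> real \<Rightarrow> real \<Rightarrow> (real ^ 'd \<Rightarrow> complex) set" where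
  "A_class \<psi> r \<beta> = {f. \<exists>a :: int ^ 'd \<Rightarrow> complex.
      (\<lambda>k. norm (a k)) summable_on UNIV \<and>
      (\<forall>x. f x = (\<Sum>\<^sub>\<infinity>k. a k * \<psi> k x)) \<and>
      (\<forall>j::nat. (\<Sum>k\<in>dyadic_block j. (norm (a k)) powr \<beta>) powr (1 / \<beta>) \<le> 2 powr (- r * real j))}"

definition optimal_recovery ::
  "'a set \<Rightarrow> 'a measure \<Rightarrow> real \<Rightarrow> nat \<Rightarrow> ('a \<Rightarrow> complex) set \<Rightarrow> ereal" where
  "optimal_recovery \<Omega> \<mu> p m F =
     (INF \<xi>\<in>{\<xi>. length \<xi> = m \<and> set \<xi> \<subseteq> \<Omega>}.
        INF M\<in>{M :: complex list \<Rightarrow> 'a \<Rightarrow> complex. \<forall>y. in_Lp \<mu> p (M y)}.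
          SUP f\<in>F. ereal (Lp_norm \<mu> p (\<lambda>x. f x - M (map f \<xi>) x)))"

end

theory Submission
  imports Defs
begin

text \<open>
  Sampling. Let \<open>A\<close> bound the coefficient sum of a \<open>2v\<close>-sparse polynomial with unit \<open>L\<^sub>2\<close> norm; the Bessel
  property gives \<open>A\<^sup>2 \<approx> K v\<close>. For the level set where \<open>\<bar>f\<bar> \<ge> 2\<^sup>i\<close>, Maurey's empirical method approximates \<open>f\<close>
  to precision \<open>2\<^sup>i/4\<close>, off a set of tiny measure, by an average of about \<open>A\<^sup>2 4\<^sup>-\<^sup>i log v\<close> dictionary elements.
  There are only \<open>exp (A\<^sup>2 4\<^sup>-\<^sup>i log\<^sup>2 v)\<close> such averages, while a sample of size \<open>m\<close> misses half of a set of measure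
  \<open>4\<^sup>-\<^sup>i / log v\<close> with probability at most \<open>exp (- c m 4\<^sup>-\<^sup>i / log v)\<close>. The factors \<open>4\<^sup>-\<^sup>i\<close> cancel, so a union bound
  over all levels needs only \<open>m \<ge> c v log\<^sup>3 v\<close>, and summing over the levels bounds the \<open>L\<^sub>2\<close> norm by the discrete one.

  Recovery. The coefficients of a function in the class lie in weak \<open>\<ell>\<^sub>s\<close> with \<open>1/s = 1/\<beta> + r/d\<close>. Keeping the
  \<open>v/2\<close> largest ones and replacing the rest by a \<open>v/2\<close>-term Maurey average gives a \<open>v\<close>-sparse \<open>h\<close> close to \<open>f\<close>
  both in \<open>L\<^sub>p\<close> and on the sample. Any \<open>v\<close>-sparse \<open>g\<close> that fits the samples equally well satisfies
  \<open>\<parallel>g - h\<parallel>\<^sub>p \<le> H \<parallel>g - h\<parallel>\<^sub>2\<close>, and the right-hand side is controlled by the discrete norm.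
\<close>

section \<open>Maurey's method and sampling\<close>

text \<open>The exceptional set of Maurey's approximation depends on the function, so it cannot be
  among the finitely many sets that the sample is tested on. The order of choices removes this
  circularity: the sample is fixed first, looking only at level sets of the averages, and Maurey's
  method is then run for each function with the sample already known, so that one choice makes the
  exceptional set small under \<mu> and under the empirical measure. For the counting, all averages
  carry one common factor A and draw their frequencies from one cube \<open>Q\<close> with log (card
  Q) = O(log v). Beyond that cube the functions of the class are uniformly O(v^(-1/\<beta> - r/d)),
  so recovery may ignore those frequencies. The three logarithms are the number of levels, the one
  in the length of the averages, and log (card Q). The Bessel constant enters only through A, hence
  only through m; this is why C can be chosen before K. No product probability space is built:
  averages are drawn by finite weighted sums, and sample points one at a time by keeping an
  exponential potential from growing.\<close>

lemma exp_le_quadratic: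
  fixes x :: real
  assumes "\<bar>x\<bar> \<le> 1"
  shows "exp x \<le> 1 + x + x\<^sup>2"
proof (cases "x \<ge> 0")
  case True
  then show ?thesis using assms exp_bound[of x] by simp
next
  case False
  define y where "y = - x"
  have y: "0 < y" "y \<le> 1" using False assms by (auto simp: y_def)
  have "1 + y \<le> exp y" by (rule exp_ge_add_one_self)
  \<comment> \<open>This identity turns \<open>1 + y \<le> exp y\<close> into the required bound for
    the reciprocal \<open>exp (- y)\<close>.\<close>
  moreover have "(1 - y + y\<^sup>2) * (1 + y) = 1 + y^3" by (simp add: algebra_simps power2_eq_square power3_eq_cube)
  moreover have "0 \<le> 1 - y + y\<^sup>2" using y by simp
  ultimately have "1 \<le> (1 - y + y\<^sup>2) * exp y"
    by (smt (verit) mult_left_mono y(1) zero_less_power)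
  then have "exp (- y) \<le> 1 - y + y\<^sup>2"
    by (simp add: exp_minus field_simps)
  then show ?thesis by (simp add: y_def)
qed

text \<open>Hoeffding's moment bound in a crude form: centring cancels the linear term of the
  expansion. Centred values are at most 2 in modulus, so |l| <= 1/2 keeps the exponent in the range
  of \<open>exp_le_quadratic\<close>, and 4 is the square of that 2.\<close>

lemma weighted_exp_le:
  fixes w X :: "'i \<Rightarrow> real"
  assumes fin: "finite D" and w: "\<And>z. z \<in> D \<Longrightarrow> 0 \<le> w z" "sum w D = 1"
    and X: "\<And>z. z \<in> D \<Longrightarrow> \<bar>X z\<bar> \<le> 1" and l: "\<bar>l\<bar> \<le> 1/2"
  shows "(\<Sum>z\<in>D. w z * exp (l * (X z - (\<Sum>y\<in>D. w y * X y)))) \<le> exp (4 * l\<^sup>2)"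
proof -
  define e where "e = (\<Sum>y\<in>D. w y * X y)"
  have "\<bar>e\<bar> \<le> (\<Sum>y\<in>D. \<bar>w y * X y\<bar>)" unfolding e_def by (rule sum_abs)
  also have "\<dots> \<le> (\<Sum>y\<in>D. w y)"
    by (intro sum_mono) (use w X in \<open>auto simp: abs_mult intro: mult_left_le\<close>)
  finally have e: "\<bar>e\<bar> \<le> 1" using w by simp
  have "w z * exp (l * (X z - e)) \<le> w z * (1 + l * (X z - e) + 4 * l\<^sup>2)" if z: "z \<in> D" for z
  proof (intro mult_left_mono w z)
    have d: "\<bar>X z - e\<bar> \<le> 2" using X[OF z] e by linarith
    have "\<bar>l * (X z - e)\<bar> \<le> 1/2 * 2" unfolding abs_mult by (intro mult_mono l d) auto
    then have "exp (l * (X z - e)) \<le> 1 + l * (X z - e) + (l * (X z - e))\<^sup>2"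
      by (intro exp_le_quadratic) simp
    also have "(l * (X z - e))\<^sup>2 \<le> l\<^sup>2 * 2\<^sup>2"
      unfolding power_mult_distrib using d by (intro mult_left_mono abs_le_square_iff[THEN iffD1]) auto
    finally show "exp (l * (X z - e)) \<le> 1 + l * (X z - e) + 4 * l\<^sup>2" by simp
  qed
  then have "(\<Sum>z\<in>D. w z * exp (l * (X z - e))) \<le> (\<Sum>z\<in>D. w z * (1 + l * (X z - e) + 4 * l\<^sup>2))"
    by (rule sum_mono)
  also have "\<dots> = (\<Sum>z\<in>D. (1 - l * e + 4 * l\<^sup>2) * w z + l * (w z * X z))"
    by (simp add: algebra_simps)
  also have "\<dots> = 1 + 4 * l\<^sup>2"
    by (simp add: sum.distrib sum_distrib_left[symmetric] w e_def)
  also have "\<dots> \<le> exp (4 * l\<^sup>2)" by (rule exp_ge_add_one_self)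
  finally show ?thesis unfolding e_def .
qed

text \<open>Independence in finite form: the weights \<open>\<Prod>i<s. w (g i)\<close> are the law
  of \<open>s\<close> independent draws from \<open>D\<close>, and the sum over the function space
  factors into \<open>s\<close> equal one-draw moments.\<close>

lemma product_exp_le:
  fixes w X :: "'i \<Rightarrow> real"
  assumes fin: "finite D" and w: "\<And>z. z \<in> D \<Longrightarrow> 0 \<le> w z" "sum w D = 1"
    and X: "\<And>z. z \<in> D \<Longrightarrow> \<bar>X z\<bar> \<le> 1" and l: "\<bar>l\<bar> \<le> 1/2"
  shows "(\<Sum>g\<in>PiE {..<s} (\<lambda>_. D). (\<Prod>i<s. w (g i)) * exp (l * ((\<Sum>i<s. X (g i)) - real s * (\<Sum>y\<in>D. w y * X y))))
    \<le> exp (4 * l\<^sup>2 * real s)"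
proof -
  define e where "e = (\<Sum>y\<in>D. w y * X y)"
  have "(\<Sum>g\<in>PiE {..<s} (\<lambda>_. D). (\<Prod>i<s. w (g i)) * exp (l * ((\<Sum>i<s. X (g i)) - real s * e)))
      = (\<Sum>g\<in>PiE {..<s} (\<lambda>_. D). \<Prod>i<s. w (g i) * exp (l * (X (g i) - e)))"
    by (simp add: prod.distrib exp_sum[symmetric] sum_distrib_left[symmetric] sum_subtractf)
  also have "\<dots> = (\<Prod>i<s. \<Sum>z\<in>D. w z * exp (l * (X z - e)))"
    by (subst prod_sum_PiE) (use fin in auto)
  also have "\<dots> = (\<Sum>z\<in>D. w z * exp (l * (X z - e))) ^ s" by simp
  also have "\<dots> \<le> exp (4 * l\<^sup>2) ^ s"
    unfolding e_def by (intro power_mono weighted_exp_le assms sum_nonneg) (use w in auto)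
  also have "\<dots> = exp (4 * l\<^sup>2 * real s)"
    by (simp add: exp_of_nat_mult[symmetric] mult.commute)
  finally show ?thesis unfolding e_def .
qed

text \<open>A stand-in for exp (l * norm z) made of four real exponentials, so that the real moment
  bound can be applied to each summand of a complex sum.\<close>

definition exp_gauge :: "real \<Rightarrow> complex \<Rightarrow> real" where
  "exp_gauge l z = exp (l * Re z) + exp (- l * Re z) + exp (l * Im z) + exp (- l * Im z)"

lemma exp_gauge_nonneg: "0 \<le> exp_gauge l z"
  by (simp add: exp_gauge_def add_nonneg_nonneg)

text \<open>One of the four numbers +-Re z, +-Im z is at least half of the modulus, and its
  exponential alone suffices. This is the origin of the factor 1/2.\<close>

lemma exp_norm_le_exp_gauge:
  assumes "0 \<le> l"
  shows "exp (l * norm z / 2) \<le> exp_gauge l z"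
proof -
  have "norm z / 2 \<le> \<bar>Re z\<bar> \<or> norm z / 2 \<le> \<bar>Im z\<bar>" using cmod_le[of z] by linarith
  then have "norm z / 2 \<le> Re z \<or> norm z / 2 \<le> - Re z \<or> norm z / 2 \<le> Im z \<or> norm z / 2 \<le> - Im z"
    by linarith
  then have "l * (norm z / 2) \<le> l * Re z \<or> l * (norm z / 2) \<le> l * (- Re z) \<or>
      l * (norm z / 2) \<le> l * Im z \<or> l * (norm z / 2) \<le> l * (- Im z)"
    by (blast intro: mult_left_mono assms)
  then have "exp (l * norm z / 2) \<le> exp (l * Re z) \<or> exp (l * norm z / 2) \<le> exp (- l * Re z) \<or>
      exp (l * norm z / 2) \<le> exp (l * Im z) \<or> exp (l * norm z / 2) \<le> exp (- l * Im z)"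
    by simp
  then show ?thesis
    unfolding exp_gauge_def
    using exp_gt_zero[of "l * Re z"] exp_gt_zero[of "- l * Re z"] exp_gt_zero[of "l * Im z"]
      exp_gt_zero[of "- l * Im z"] by linarith
qed

text \<open>Passes from exponential moments to q-th moments. The constant comes from y <= exp y at y
  = l * norm z / (2 q), raised to the power q; it is the source of the factor p in the recovery
  error.\<close>

lemma norm_powr_le_exp_gauge:
  assumes "0 < l" "0 < q"
  shows "norm z powr q \<le> (2 * q / l) powr q * exp_gauge l z"
proof -
  let ?y = "l * norm z / (2 * q)"
  have "?y \<le> exp ?y" using exp_ge_add_one_self[of ?y] by linarith
  then have "?y powr q \<le> exp ?y powr q" using assms by (intro powr_mono2) auto
  also have "exp ?y powr q = exp (l * norm z / 2)" using assms by (simp add: powr_def)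
  also have "\<dots> \<le> exp_gauge l z" using assms by (intro exp_norm_le_exp_gauge) auto
  finally have "(2 * q / l) powr q * ?y powr q \<le> (2 * q / l) powr q * exp_gauge l z"
    by (intro mult_left_mono) auto
  moreover have "(2 * q / l) powr q * ?y powr q = norm z powr q"
    using assms by (subst powr_mult[symmetric]) auto
  ultimately show ?thesis by simp
qed

lemma product_exp_gauge_le:
  fixes w :: "'i \<Rightarrow> real" and \<phi> :: "'i \<Rightarrow> complex"
  assumes fin: "finite D" and w: "\<And>z. z \<in> D \<Longrightarrow> 0 \<le> w z" "sum w D = 1"
    and \<phi>: "\<And>z. z \<in> D \<Longrightarrow> norm (\<phi> z) \<le> 1" and l: "\<bar>l\<bar> \<le> 1/2"
  shows "(\<Sum>g\<in>PiE {..<s} (\<lambda>_. D). (\<Prod>i<s. w (g i)) *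
      exp_gauge l ((\<Sum>i<s. \<phi> (g i)) - of_nat s * (\<Sum>y\<in>D. of_real (w y) * \<phi> y)))
    \<le> 4 * exp (4 * l\<^sup>2 * real s)"
proof -
  have R: "\<forall>z\<in>D. \<bar>Re (\<phi> z)\<bar> \<le> 1" and I: "\<forall>z\<in>D. \<bar>Im (\<phi> z)\<bar> \<le> 1"
    using \<phi> order_trans[OF abs_Re_le_cmod] order_trans[OF abs_Im_le_cmod] by blast+
  have P: "(\<Sum>g\<in>PiE {..<s} (\<lambda>_. D). (\<Prod>i<s. w (g i)) * exp (l * ((\<Sum>i<s. X (g i)) - real s * (\<Sum>y\<in>D. w y * X y))))
    \<le> exp (4 * l\<^sup>2 * real s)" if "\<forall>z\<in>D. \<bar>X z\<bar> \<le> 1" "\<bar>l\<bar> \<le> 1/2" for X l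
    using that by (intro product_exp_le fin w) auto
  have l': "\<bar>- l\<bar> \<le> 1/2" using l by simp
  have split: "(\<Sum>g\<in>PiE {..<s} (\<lambda>_. D). (\<Prod>i<s. w (g i)) * exp_gauge l (S g))
      = (\<Sum>g\<in>PiE {..<s} (\<lambda>_. D). (\<Prod>i<s. w (g i)) * exp (l * Re (S g)))
      + (\<Sum>g\<in>PiE {..<s} (\<lambda>_. D). (\<Prod>i<s. w (g i)) * exp (- l * Re (S g)))
      + (\<Sum>g\<in>PiE {..<s} (\<lambda>_. D). (\<Prod>i<s. w (g i)) * exp (l * Im (S g)))
      + (\<Sum>g\<in>PiE {..<s} (\<lambda>_. D). (\<Prod>i<s. w (g i)) * exp (- l * Im (S g)))" for S
    unfolding exp_gauge_def distrib_left sum.distrib ..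
  define S where "S g = (\<Sum>i<s. \<phi> (g i)) - of_nat s * (\<Sum>y\<in>D. of_real (w y) * \<phi> y)" for g
  have ReS: "Re (S g) = (\<Sum>i<s. Re (\<phi> (g i))) - real s * (\<Sum>y\<in>D. w y * Re (\<phi> y))"
    and ImS: "Im (S g) = (\<Sum>i<s. Im (\<phi> (g i))) - real s * (\<Sum>y\<in>D. w y * Im (\<phi> y))" for g
    by (simp_all add: S_def)
  show ?thesis
    unfolding S_def[symmetric] split unfolding ReS ImS
    using P[OF R l] P[OF R l'] P[OF I l] P[OF I l']
    unfolding power2_minus by linarith
qed

lemma exists_le_weighted_sum:
  fixes W G :: "'i \<Rightarrow> real"
  assumes fin: "finite A" and W: "\<And>a. a \<in> A \<Longrightarrow> 0 \<le> W a" "sum W A = 1" and le: "(\<Sum>a\<in>A. W a * G a) \<le> c"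
  shows "\<exists>a\<in>A. G a \<le> c"
proof (rule ccontr)
  assume "\<not> ?thesis"
  then have gt: "c < G a" if "a \<in> A" for a using that by force
  obtain b where b: "b \<in> A" "W b > 0"
    using W by (metis less_eq_real_def sum.neutral zero_neq_one)
  have "c = (\<Sum>a\<in>A. W a * c)" using W by (simp add: sum_distrib_right[symmetric])
  also have "\<dots> < (\<Sum>a\<in>A. W a * G a)"
    using fin b W gt by (intro sum_strict_mono_ex1 ballI mult_left_mono bexI[of _ b]) (auto intro: less_imp_le)
  finally show False using le by simp
qed

text \<open>Maurey's empirical method for two measures at once: \<open>M\<close> and the uniform measure on the sample \<open>\<xi>\<close>.\<close>

lemma maurey_exists:
  fixes w :: "'i \<Rightarrow> real" and \<phi> :: "'i \<Rightarrow> 'a \<Rightarrow> complex" and \<xi> :: "nat \<Rightarrow> 'a" and s :: nat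
  assumes M: "prob_space M"
    and fin: "finite D" and w: "\<And>z. z \<in> D \<Longrightarrow> 0 \<le> w z" "sum w D = 1"
    and \<phi>: "\<And>z x. z \<in> D \<Longrightarrow> x \<in> space M \<Longrightarrow> norm (\<phi> z x) \<le> 1"
    and meas: "\<And>z. z \<in> D \<Longrightarrow> \<phi> z \<in> borel_measurable M"
    and l: "\<bar>l\<bar> \<le> 1/2" and \<xi>: "\<And>j. j < m \<Longrightarrow> \<xi> j \<in> space M" and m: "0 < m"
  defines "S \<equiv> \<lambda>g x. (\<Sum>i<s. \<phi> (g i) x) - of_nat s * (\<Sum>y\<in>D. of_real (w y) * \<phi> y x)"
  shows "\<exists>g\<in>PiE {..<s} (\<lambda>_. D).
      integrable M (\<lambda>x. exp_gauge l (S g x)) \<and>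
      (\<integral>x. exp_gauge l (S g x) \<partial>M) \<le> 8 * exp (4 * l\<^sup>2 * real s) \<and>
      (\<Sum>j<m. exp_gauge l (S g (\<xi> j))) / real m \<le> 8 * exp (4 * l\<^sup>2 * real s)"
proof -
  interpret prob_space M by (rule M)
  let ?A = "PiE {..<s} (\<lambda>_. D)"
  let ?W = "\<lambda>g. \<Prod>i<s. w (g i)"
  define b where "b = exp (4 * l\<^sup>2 * real s)"
  have finA: "finite ?A" using fin by (intro finite_PiE) auto
  have W0: "0 \<le> ?W g" if "g \<in> ?A" for g using that w by (intro prod_nonneg) auto
  have W1: "sum ?W ?A = 1" by (subst prod_sum_PiE[symmetric]) (use fin w in auto)
  have SM: "S g \<in> borel_measurable M" if "g \<in> ?A" for g
    unfolding S_def using that meas by (intro borel_measurable_diff borel_measurable_sum borel_measurable_times) auto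
  have Sb: "norm (S g x) \<le> 2 * real s" if "g \<in> ?A" "x \<in> space M" for g x
  proof -
    have "norm (\<Sum>i<s. \<phi> (g i) x) \<le> (\<Sum>i<s. 1)"
      using that by (intro order_trans[OF norm_sum] sum_mono \<phi>) auto
    moreover have "norm (\<Sum>y\<in>D. of_real (w y) * \<phi> y x) \<le> (\<Sum>y\<in>D. w y)"
      using that w \<phi> by (intro order_trans[OF norm_sum] sum_mono) (auto simp: norm_mult intro!: mult_left_le)
    then have "norm (of_nat s * (\<Sum>y\<in>D. of_real (w y) * \<phi> y x)) \<le> real s * 1"
      unfolding norm_mult w by (intro mult_mono) auto
    ultimately show ?thesis unfolding S_def
      by (intro order_trans[OF norm_triangle_ineq4]) auto
  qed
  have int: "integrable M (\<lambda>x. exp_gauge l (S g x))" if g: "g \<in> ?A" for g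
  proof (rule integrable_const_bound)
    have "exp_gauge l (S g x) \<le> 4 * exp (\<bar>l\<bar> * (2 * real s))" if x: "x \<in> space M" for x
    proof -
      have "\<bar>l * Re (S g x)\<bar> \<le> \<bar>l\<bar> * (2 * real s)" "\<bar>l * Im (S g x)\<bar> \<le> \<bar>l\<bar> * (2 * real s)"
        unfolding abs_mult using Sb[OF g x] abs_Re_le_cmod[of "S g x"] abs_Im_le_cmod[of "S g x"]
        by (auto intro!: mult_left_mono)
      then have "exp (l * Re (S g x)) \<le> exp (\<bar>l\<bar> * (2 * real s))" "exp (- l * Re (S g x)) \<le> exp (\<bar>l\<bar> * (2 * real s))"
        "exp (l * Im (S g x)) \<le> exp (\<bar>l\<bar> * (2 * real s))" "exp (- l * Im (S g x)) \<le> exp (\<bar>l\<bar> * (2 * real s))"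
        by auto
      then show ?thesis unfolding exp_gauge_def by linarith
    qed
    then show "AE x in M. norm (exp_gauge l (S g x)) \<le> 4 * exp (\<bar>l\<bar> * (2 * real s))"
      by (intro AE_I2) (simp add: exp_gauge_nonneg)
    show "(\<lambda>x. exp_gauge l (S g x)) \<in> borel_measurable M"
      unfolding exp_gauge_def using SM[OF g] by measurable
  qed
  have pt: "(\<Sum>g\<in>?A. ?W g * exp_gauge l (S g x)) \<le> 4 * b" if "x \<in> space M" for x
    unfolding S_def b_def using that by (intro product_exp_gauge_le fin w \<phi> l) auto
  \<comment> \<open>Both quantities are nonnegative, so a single \<open>g\<close> below the mean of
    their sum controls each of them; the price is 8 instead of 4.\<close>
  have "(\<Sum>g\<in>?A. ?W g * ((\<integral>x. exp_gauge l (S g x) \<partial>M) + (\<Sum>j<m. exp_gauge l (S g (\<xi> j))) / real m)) \<le> 8 * b"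
  proof -
    have "(\<Sum>g\<in>?A. ?W g * (\<integral>x. exp_gauge l (S g x) \<partial>M)) = (\<integral>x. (\<Sum>g\<in>?A. ?W g * exp_gauge l (S g x)) \<partial>M)"
      using int by simp
    also have "\<dots> \<le> 4 * b"
      using pt int by (intro integral_le_const AE_I2) auto
    finally have 1: "(\<Sum>g\<in>?A. ?W g * (\<integral>x. exp_gauge l (S g x) \<partial>M)) \<le> 4 * b" .
    have "(\<Sum>g\<in>?A. ?W g * ((\<Sum>j<m. exp_gauge l (S g (\<xi> j))) / real m)) = (\<Sum>j<m. \<Sum>g\<in>?A. ?W g * exp_gauge l (S g (\<xi> j))) / real m"
      by (subst sum.swap) (simp add: sum_distrib_left sum_divide_distrib)
    also have "\<dots> \<le> (\<Sum>j<m. 4 * b) / real m"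
      using pt \<xi> by (intro divide_right_mono sum_mono) auto
    also have "\<dots> = 4 * b" using m by simp
    finally have 2: "(\<Sum>g\<in>?A. ?W g * ((\<Sum>j<m. exp_gauge l (S g (\<xi> j))) / real m)) \<le> 4 * b" .
    show ?thesis using 1 2 by (simp add: distrib_left sum.distrib)
  qed
  from exists_le_weighted_sum[OF finA W0 W1 this] obtain g where g: "g \<in> ?A"
    and le: "(\<integral>x. exp_gauge l (S g x) \<partial>M) + (\<Sum>j<m. exp_gauge l (S g (\<xi> j))) / real m \<le> 8 * b" by auto
  moreover have "0 \<le> (\<integral>x. exp_gauge l (S g x) \<partial>M)" "0 \<le> (\<Sum>j<m. exp_gauge l (S g (\<xi> j))) / real m"
    by (auto intro!: integral_nonneg sum_nonneg divide_nonneg_nonneg simp: exp_gauge_nonneg)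
  ultimately show ?thesis using int[OF g] unfolding b_def by (intro bexI[of _ g]) auto
qed

text \<open>Chernoff's bound by conditional expectations. The potential, the sum of exp (n * measure
  / 2 - hits) weighted by \<open>?w\<close>, does not increase on average when a random point is
  added, so some point keeps it below its initial value, which is less than 1. After m points every
  single term is below 1, and 1/2 - 1/8 = 3/8 is the guaranteed rate of hits.\<close>

lemma sampling_points_exist:
  fixes \<E> :: "'a set set"
  assumes M: "prob_space M" and fin: "finite \<E>" and sets: "\<E> \<subseteq> sets M"
    and small: "(\<Sum>E\<in>\<E>. exp (- real m * measure M E / 8)) < 1"
  shows "\<exists>\<xi>::nat \<Rightarrow> 'a. (\<forall>j<m. \<xi> j \<in> space M) \<and>
    (\<forall>E\<in>\<E>. 3/8 * real m * measure M E \<le> (\<Sum>j<m. indicat_real E (\<xi> j)))"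
proof -
  interpret prob_space M by (rule M)
  let ?w = "\<lambda>E. exp (- real m * measure M E / 8)"
  have step: "\<exists>x\<in>space M. (\<Sum>E\<in>\<E>. c E * exp (measure M E / 2 - indicat_real E x)) \<le> sum c \<E>"
    if c: "\<And>E. 0 \<le> c E" for c :: "'a set \<Rightarrow> real"
  proof (rule ccontr)
    let ?h = "\<lambda>E x. exp (measure M E / 2) * (1 - (1 - exp (-1)) * indicat_real E x)"
    have h: "exp (measure M E / 2 - indicat_real E x) = ?h E x" for E x
      unfolding diff_conv_add_uminus[of "measure M E / 2"] exp_add by (simp add: indicator_def)
    assume "\<not> ?thesis"
    then have gt: "sum c \<E> < (\<Sum>E\<in>\<E>. c E * ?h E x)" if "x \<in> space M" for x
      using that unfolding h by force
    have int: "integrable M (indicat_real E)" if "E \<in> \<E>" for E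
      using sets that by (intro integrable_real_indicator) (auto simp: emeasure_eq_measure)
    have "sum c \<E> < expectation (\<lambda>x. \<Sum>E\<in>\<E>. c E * ?h E x)"
      using gt int by (intro expectation_greater) auto
    also have "\<dots> = (\<Sum>E\<in>\<E>. c E * (exp (measure M E / 2) * (1 - (1 - exp (-1)) * measure M E)))"
      using int sets by (subst Bochner_Integration.integral_sum) (auto intro!: sum.cong simp: prob_space sets.sets_into_space[THEN Int_absorb1])
    \<comment> \<open>For one random point the factor of a set of measure t has mean exp (t/2) * (1
      - (1 - 1/e) t). Since 1 - 1/e >= 1/2, this is at most exp (t/2) * exp (- t/2) = 1.\<close>
    also have "\<dots> \<le> (\<Sum>E\<in>\<E>. c E * 1)"
    proof (intro sum_mono mult_left_mono c)
      fix E
      have "2 \<le> exp (1::real)" using exp_ge_add_one_self[of 1] by simp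
      then have "exp (-1) \<le> (1/2::real)" by (simp add: exp_minus field_simps)
      then have "1 - (1 - exp (-1)) * measure M E \<le> 1 + (- (measure M E / 2))"
        using mult_right_mono[of "1/2" "1 - exp (-1)" "measure M E"] by simp
      also have "\<dots> \<le> exp (- (measure M E / 2))" by (rule exp_ge_add_one_self)
      finally have "exp (measure M E / 2) * (1 - (1 - exp (-1)) * measure M E) \<le> exp (measure M E / 2) * exp (- (measure M E / 2))"
        by (intro mult_left_mono) auto
      then show "exp (measure M E / 2) * (1 - (1 - exp (-1)) * measure M E) \<le> 1"
        by (simp add: exp_minus)
    qed
    finally show False by simp
  qed
  have "\<exists>\<xi>::nat \<Rightarrow> 'a. (\<forall>j<n. \<xi> j \<in> space M) \<and>
    (\<Sum>E\<in>\<E>. ?w E * exp (real n * measure M E / 2 - (\<Sum>j<n. indicat_real E (\<xi> j)))) \<le> sum ?w \<E>" for n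
  proof (induction n)
    case 0
    show ?case by simp
  next
    case (Suc n)
    then obtain \<xi> where \<xi>: "\<forall>j<n. \<xi> j \<in> space M"
      and le: "(\<Sum>E\<in>\<E>. ?w E * exp (real n * measure M E / 2 - (\<Sum>j<n. indicat_real E (\<xi> j)))) \<le> sum ?w \<E>" by blast
    obtain x where x: "x \<in> space M"
      and lex: "(\<Sum>E\<in>\<E>. (?w E * exp (real n * measure M E / 2 - (\<Sum>j<n. indicat_real E (\<xi> j)))) * exp (measure M E / 2 - indicat_real E x))
        \<le> (\<Sum>E\<in>\<E>. ?w E * exp (real n * measure M E / 2 - (\<Sum>j<n. indicat_real E (\<xi> j))))"
      using step[of "\<lambda>E. ?w E * exp (real n * measure M E / 2 - (\<Sum>j<n. indicat_real E (\<xi> j)))"] by auto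
    let ?\<xi> = "\<xi>(n := x)"
    have eq: "exp (real (Suc n) * measure M E / 2 - (\<Sum>j<Suc n. indicat_real E (?\<xi> j)))
       = exp (real n * measure M E / 2 - (\<Sum>j<n. indicat_real E (\<xi> j))) * exp (measure M E / 2 - indicat_real E x)" for E
      by (simp add: exp_add[symmetric] field_simps)
    have "(\<Sum>E\<in>\<E>. ?w E * exp (real (Suc n) * measure M E / 2 - (\<Sum>j<Suc n. indicat_real E (?\<xi> j)))) \<le> sum ?w \<E>"
      unfolding eq using lex le by (simp add: mult.assoc)
    then show ?case using \<xi> x by (intro exI[of _ ?\<xi>]) (auto simp: less_Suc_eq)
  qed
  from this[of m] obtain \<xi> where \<xi>: "\<forall>j<m. \<xi> j \<in> space M"
    and le: "(\<Sum>E\<in>\<E>. ?w E * exp (real m * measure M E / 2 - (\<Sum>j<m. indicat_real E (\<xi> j)))) \<le> sum ?w \<E>" by blast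
  have "3/8 * real m * measure M E \<le> (\<Sum>j<m. indicat_real E (\<xi> j))" if E: "E \<in> \<E>" for E
  proof -
    have "?w E * exp (real m * measure M E / 2 - (\<Sum>j<m. indicat_real E (\<xi> j))) < 1"
      using member_le_sum[OF E, of "\<lambda>E. ?w E * exp (real m * measure M E / 2 - (\<Sum>j<m. indicat_real E (\<xi> j)))"] fin le small
      by fastforce
    then have "exp (- real m * measure M E / 8 + (real m * measure M E / 2 - (\<Sum>j<m. indicat_real E (\<xi> j)))) < exp 0"
      by (simp only: exp_add exp_zero)
    then show ?thesis unfolding exp_less_cancel_iff by (simp add: field_simps)
  qed
  with \<xi> show ?thesis by blast
qed

section \<open>Dictionary averages\<close>

text \<open>The four units carry the signs of real and imaginary parts, so that all weights can be
  nonnegative. The value 0 represents the zero function and takes up whatever weight is missing from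
  1.\<close>

definition phases :: "complex set" where
  "phases = {0, 1, - 1, \<i>, - \<i>}"

lemma finite_phases: "finite phases" and card_phases: "card phases = 5"
  and norm_phases: "c \<in> phases \<Longrightarrow> norm c \<le> 1"
  by (auto simp: phases_def complex_eq_iff cmod_def)

lemma sum_phases: "sum h phases = h 0 + (h 1 + (h (- 1) + (h \<i> + h (- \<i>))))"
  by (simp add: phases_def complex_eq_iff)

text \<open>Exhibits the sum as a point of A times the convex hull of the dictionary, which is the
  input of Maurey's method. \<open>A\<close> may exceed the coefficient sum, so one and the same
  \<open>A\<close> serves many functions.\<close>

lemma l1_convex_decomposition:
  fixes a :: "'i \<Rightarrow> complex"
  assumes Q: "finite Q" "Q \<noteq> {}" and A: "0 < A" and le: "(\<Sum>k\<in>Q. \<bar>Re (a k)\<bar> + \<bar>Im (a k)\<bar>) \<le> A"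
  obtains w :: "'i \<times> complex \<Rightarrow> real" where "\<And>z. z \<in> Q \<times> phases \<Longrightarrow> 0 \<le> w z" "sum w (Q \<times> phases) = 1"
    "\<And>b. (\<Sum>k\<in>Q. a k * b k) = of_real A * (\<Sum>z\<in>Q \<times> phases. of_real (w z) * (snd z * b (fst z)))"
proof -
  define slack where "slack = 1 - (\<Sum>k\<in>Q. \<bar>Re (a k)\<bar> + \<bar>Im (a k)\<bar>) / A"
  have slack: "0 \<le> slack" using le A by (simp add: slack_def)
  have card: "0 < card Q" using Q by (simp add: card_gt_0_iff)
  define w where "w = (\<lambda>(k, c).
      if c = 1 then max (Re (a k)) 0 / A
      else if c = - 1 then max (- Re (a k)) 0 / A
      else if c = \<i> then max (Im (a k)) 0 / A
      else if c = - \<i> then max (- Im (a k)) 0 / A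
      else slack / card Q)"
  have wv: "w (k, 1) = max (Re (a k)) 0 / A" "w (k, - 1) = max (- Re (a k)) 0 / A"
    "w (k, \<i>) = max (Im (a k)) 0 / A" "w (k, - \<i>) = max (- Im (a k)) 0 / A"
    "w (k, 0) = slack / card Q" for k
    by (simp_all add: w_def complex_eq_iff)
  have "0 \<le> w z" for z using A slack by (auto simp: w_def split: prod.split)
  moreover have "sum w (Q \<times> phases) = 1"
  proof -
    have "sum w (Q \<times> phases) = (\<Sum>k\<in>Q. \<Sum>c\<in>phases. w (k, c))"
      by (simp add: sum.cartesian_product)
    also have "\<dots> = (\<Sum>k\<in>Q. slack / card Q + (\<bar>Re (a k)\<bar> + \<bar>Im (a k)\<bar>) / A)"
      unfolding sum_phases wv by (intro sum.cong refl) (auto simp: max_def add_divide_distrib diff_divide_distrib)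
    also have "\<dots> = 1" using card by (simp add: sum.distrib slack_def sum_divide_distrib[symmetric])
    finally show ?thesis .
  qed
  moreover have "(\<Sum>k\<in>Q. a k * b k) = of_real A * (\<Sum>z\<in>Q \<times> phases. of_real (w z) * (snd z * b (fst z)))" for b
  proof -
    have "of_real A * (\<Sum>c\<in>phases. of_real (w (k, c)) * (c * b k)) = a k * b k" for k
    proof -
      have "of_real A * (\<Sum>c\<in>phases. of_real (w (k, c)) * (c * b k))
          = of_real A * (of_real (w (k, 1) - w (k, -1)) + \<i> * of_real (w (k, \<i>) - w (k, - \<i>))) * b k"
        unfolding sum_phases by (simp add: algebra_simps)
      also have "w (k, 1) - w (k, -1) = Re (a k) / A"
        unfolding wv by (simp add: max_def field_simps)
      also have "w (k, \<i>) - w (k, -\<i>) = Im (a k) / A"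
        unfolding wv by (simp add: max_def field_simps)
      also have "of_real A * (of_real (Re (a k) / A) + \<i> * of_real (Im (a k) / A)) = a k"
        using A by (simp add: complex_eq_iff)
      finally show ?thesis .
    qed
    then have "(\<Sum>k\<in>Q. a k * b k) = (\<Sum>k\<in>Q. of_real A * (\<Sum>c\<in>phases. of_real (w (k, c)) * (c * b k)))" by simp
    also have "\<dots> = of_real A * (\<Sum>z\<in>Q \<times> phases. of_real (w z) * (snd z * b (fst z)))"
      by (simp add: sum_distrib_left[symmetric] sum.cartesian_product split_def)
    finally show ?thesis .
  qed
  ultimately show ?thesis using that by blast
qed

text \<open>The factor \<open>A / s\<close> does not depend on the function to be approximated.
  Hence for fixed \<open>s\<close> and finite \<open>Q\<close> there are at most (5 * card Q)^s
  averages in all, which is what the union bound counts.\<close>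

definition dict_average :: "('i \<Rightarrow> 'a \<Rightarrow> complex) \<Rightarrow> real \<Rightarrow> nat \<Rightarrow> (nat \<Rightarrow> 'i \<times> complex) \<Rightarrow> 'a \<Rightarrow> complex" where
  "dict_average \<psi> A s g x = of_real (A / real s) * (\<Sum>i<s. snd (g i) * \<psi> (fst (g i)) x)"

text \<open>Merging repeated frequencies makes an average of length \<open>s\<close> an
  \<open>s\<close>-sparse polynomial, the form in which sparsity is measured later.\<close>

lemma dict_average_eq_sum:
  assumes "\<And>i. i < s \<Longrightarrow> fst (g i) \<in> Q"
  obtains S a where "S \<subseteq> Q" "finite S" "card S \<le> s" "\<And>x. dict_average \<psi> A s g x = (\<Sum>k\<in>S. a k * \<psi> k x)"
proof
  let ?S = "(\<lambda>i. fst (g i)) ` {..<s}"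
  let ?a = "\<lambda>k. of_real (A / real s) * (\<Sum>i | i \<in> {..<s} \<and> fst (g i) = k. snd (g i))"
  show "?S \<subseteq> Q" using assms by auto
  show "finite ?S" by simp
  show "card ?S \<le> s" using card_image_le[of "{..<s}" "\<lambda>i. fst (g i)"] by simp
  fix x
  have "(\<Sum>i<s. snd (g i) * \<psi> (fst (g i)) x)
      = (\<Sum>k\<in>?S. \<Sum>i | i \<in> {..<s} \<and> fst (g i) = k. snd (g i) * \<psi> (fst (g i)) x)"
    by (subst sum.image_gen[of "{..<s}" _ "\<lambda>i. fst (g i)"]) simp_all
  also have "\<dots> = (\<Sum>k\<in>?S. (\<Sum>i | i \<in> {..<s} \<and> fst (g i) = k. snd (g i)) * \<psi> k x)"
    by (intro sum.cong refl) (auto simp: sum_distrib_right intro!: sum.cong)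
  finally show "dict_average \<psi> A s g x = (\<Sum>k\<in>?S. ?a k * \<psi> k x)"
    by (simp only: dict_average_def sum_distrib_left[where A="?S"] mult.assoc)
qed

lemma dict_average_measurable:
  assumes "\<And>k. k \<in> Q \<Longrightarrow> \<psi> k \<in> borel_measurable M" "\<And>i. i < s \<Longrightarrow> fst (g i) \<in> Q"
  shows "dict_average \<psi> A s g \<in> borel_measurable M"
  unfolding dict_average_def[abs_def] using assms by (intro borel_measurable_times borel_measurable_sum) auto

lemma sparse_approximation_exists:
  fixes \<psi> :: "'i \<Rightarrow> 'a \<Rightarrow> complex" and \<xi> :: "nat \<Rightarrow> 'a"
  assumes M: "prob_space M" and Q: "finite Q" "Q \<noteq> {}"
    and \<psi>: "\<And>k x. k \<in> Q \<Longrightarrow> x \<in> space M \<Longrightarrow> norm (\<psi> k x) \<le> 1"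
    and meas: "\<And>k. k \<in> Q \<Longrightarrow> \<psi> k \<in> borel_measurable M"
    and A: "0 < A" and a: "(\<Sum>k\<in>Q. \<bar>Re (a k)\<bar> + \<bar>Im (a k)\<bar>) \<le> A"
    and l: "\<bar>l\<bar> \<le> 1/2" and \<xi>: "\<And>j. j < m \<Longrightarrow> \<xi> j \<in> space M" and m: "0 < m" and s: "0 < s"
  obtains g where "g \<in> PiE {..<s} (\<lambda>_. Q \<times> phases)"
    "integrable M (\<lambda>x. exp_gauge l (of_real (real s / A) * (dict_average \<psi> A s g x - (\<Sum>k\<in>Q. a k * \<psi> k x))))"
    "(\<integral>x. exp_gauge l (of_real (real s / A) * (dict_average \<psi> A s g x - (\<Sum>k\<in>Q. a k * \<psi> k x))) \<partial>M) \<le> 8 * exp (4 * l\<^sup>2 * real s)"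
    "(\<Sum>j<m. exp_gauge l (of_real (real s / A) * (dict_average \<psi> A s g (\<xi> j) - (\<Sum>k\<in>Q. a k * \<psi> k (\<xi> j))))) / real m \<le> 8 * exp (4 * l\<^sup>2 * real s)"
proof -
  obtain w where w: "\<And>z. z \<in> Q \<times> phases \<Longrightarrow> 0 \<le> w z" "sum w (Q \<times> phases) = 1"
    and dec: "\<And>b. (\<Sum>k\<in>Q. a k * b k) = of_real A * (\<Sum>z\<in>Q \<times> phases. of_real (w z) * (snd z * b (fst z)))"
    using l1_convex_decomposition[OF Q A a] by blast
  define \<phi> where "\<phi> = (\<lambda>z x. snd z * \<psi> (fst z) x)"
  have fin: "finite (Q \<times> phases)" using Q finite_phases by auto
  have \<phi>: "norm (\<phi> z x) \<le> 1" if "z \<in> Q \<times> phases" "x \<in> space M" for z x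
    using that \<psi>[of "fst z" x] norm_phases[of "snd z"] by (auto simp: \<phi>_def norm_mult mult_le_one)
  have \<phi>m: "\<phi> z \<in> borel_measurable M" if "z \<in> Q \<times> phases" for z
    unfolding \<phi>_def using that meas by auto
  \<comment> \<open>Scaled by s / A, the approximation error is the centred sum of \<open>s\<close>
    draws treated by \<open>maurey_exists\<close>.\<close>
  have eq: "of_real (real s / A) * (dict_average \<psi> A s g x - (\<Sum>k\<in>Q. a k * \<psi> k x))
     = (\<Sum>i<s. \<phi> (g i) x) - of_nat s * (\<Sum>z\<in>Q \<times> phases. of_real (w z) * \<phi> z x)" for g x
  proof -
    have "of_real (real s / A) * dict_average \<psi> A s g x = (\<Sum>i<s. \<phi> (g i) x)"
      using s A by (simp add: dict_average_def \<phi>_def)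
    moreover have "of_real (real s / A) * (\<Sum>k\<in>Q. a k * \<psi> k x) = of_nat s * (\<Sum>z\<in>Q \<times> phases. of_real (w z) * \<phi> z x)"
      unfolding dec[of "\<lambda>k. \<psi> k x"] using A by (simp add: \<phi>_def)
    ultimately show ?thesis by (simp only: right_diff_distrib)
  qed
  have "\<exists>g\<in>PiE {..<s} (\<lambda>_. Q \<times> phases).
      integrable M (\<lambda>x. exp_gauge l ((\<Sum>i<s. \<phi> (g i) x) - of_nat s * (\<Sum>z\<in>Q \<times> phases. of_real (w z) * \<phi> z x))) \<and>
      (\<integral>x. exp_gauge l ((\<Sum>i<s. \<phi> (g i) x) - of_nat s * (\<Sum>z\<in>Q \<times> phases. of_real (w z) * \<phi> z x)) \<partial>M) \<le> 8 * exp (4 * l\<^sup>2 * real s) \<and>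
      (\<Sum>j<m. exp_gauge l ((\<Sum>i<s. \<phi> (g i) (\<xi> j)) - of_nat s * (\<Sum>z\<in>Q \<times> phases. of_real (w z) * \<phi> z (\<xi> j)))) / real m \<le> 8 * exp (4 * l\<^sup>2 * real s)"
    by (rule maurey_exists[OF M fin _ w(2) _ _ l _ m]) (use w(1) \<phi> \<phi>m \<xi> in auto)
  then show ?thesis using that unfolding eq by blast
qed

lemma sum_indicat_markov:
  fixes h :: "'a \<Rightarrow> real"
  assumes "\<And>x. x \<in> X \<Longrightarrow> c \<le> h x" "\<And>x. 0 \<le> h x" "0 < c" "(\<Sum>j<m. h (\<xi> j)) / real m \<le> b"
  shows "(\<Sum>j<m. indicat_real X (\<xi> j)) / real m \<le> b / c"
proof -
  have "c * (\<Sum>j<m. indicat_real X (\<xi> j)) \<le> (\<Sum>j<m. h (\<xi> j))"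
    unfolding sum_distrib_left using assms by (intro sum_mono) (auto simp: indicator_def)
  then have "c * (\<Sum>j<m. indicat_real X (\<xi> j)) / real m \<le> (\<Sum>j<m. h (\<xi> j)) / real m"
    by (intro divide_right_mono) auto
  then have "c * ((\<Sum>j<m. indicat_real X (\<xi> j)) / real m) \<le> b" using assms by simp
  then show ?thesis using assms by (simp add: pos_le_divide_eq mult.commute)
qed

lemma sparse_approximation_tail:
  fixes \<psi> :: "'i \<Rightarrow> 'a \<Rightarrow> complex" and \<xi> :: "nat \<Rightarrow> 'a"
  assumes M: "prob_space M" and Q: "finite Q" "Q \<noteq> {}"
    and \<psi>: "\<And>k x. k \<in> Q \<Longrightarrow> x \<in> space M \<Longrightarrow> norm (\<psi> k x) \<le> 1"
    and meas: "\<And>k. k \<in> Q \<Longrightarrow> \<psi> k \<in> borel_measurable M"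
    and A: "0 < A" and a: "(\<Sum>k\<in>Q. \<bar>Re (a k)\<bar> + \<bar>Im (a k)\<bar>) \<le> A"
    and \<xi>: "\<And>j. j < m \<Longrightarrow> \<xi> j \<in> space M" and m: "0 < m" and s: "0 < s"
    and \<epsilon>: "0 < \<epsilon>" "\<epsilon> \<le> 8 * A"
  obtains g X where "g \<in> PiE {..<s} (\<lambda>_. Q \<times> phases)" "X \<in> sets M"
    "\<And>x. x \<in> space M \<Longrightarrow> x \<notin> X \<Longrightarrow> norm (dict_average \<psi> A s g x - (\<Sum>k\<in>Q. a k * \<psi> k x)) < \<epsilon>"
    "measure M X \<le> 8 * exp (- real s * \<epsilon>\<^sup>2 / (64 * A\<^sup>2))"
    "(\<Sum>j<m. indicat_real X (\<xi> j)) / real m \<le> 8 * exp (- real s * \<epsilon>\<^sup>2 / (64 * A\<^sup>2))"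
proof -
  interpret prob_space M by (rule M)
  \<comment> \<open>This minimises 4 l^2 s - l s \<epsilon> / (2 A), the exponent in Markov's
    inequality for the gauge. The minimum is - s \<epsilon>^2 / (64 A^2), and \<epsilon> <= 8 A says
    that l <= 1/2.\<close>
  define l where "l = \<epsilon> / (16 * A)"
  have l: "0 < l" "\<bar>l\<bar> \<le> 1/2" using \<epsilon> A by (auto simp: l_def field_simps)
  obtain g where g: "g \<in> PiE {..<s} (\<lambda>_. Q \<times> phases)"
    and int: "integrable M (\<lambda>x. exp_gauge l (of_real (real s / A) * (dict_average \<psi> A s g x - (\<Sum>k\<in>Q. a k * \<psi> k x))))"
      (is "integrable M ?h")
    and le1: "(\<integral>x. exp_gauge l (of_real (real s / A) * (dict_average \<psi> A s g x - (\<Sum>k\<in>Q. a k * \<psi> k x))) \<partial>M) \<le> 8 * exp (4 * l\<^sup>2 * real s)"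
    and le2: "(\<Sum>j<m. exp_gauge l (of_real (real s / A) * (dict_average \<psi> A s g (\<xi> j) - (\<Sum>k\<in>Q. a k * \<psi> k (\<xi> j))))) / real m \<le> 8 * exp (4 * l\<^sup>2 * real s)"
    by (rule sparse_approximation_exists[OF M Q _ _ A a l(2) _ m s, where \<psi>=\<psi> and \<xi>=\<xi>]) (use \<psi> meas \<xi> in auto)
  define e where "e x = dict_average \<psi> A s g x - (\<Sum>k\<in>Q. a k * \<psi> k x)" for x
  define X where "X = {x \<in> space M. \<epsilon> \<le> norm (e x)}"
  have em: "e \<in> borel_measurable M"
  proof -
    have "dict_average \<psi> A s g \<in> borel_measurable M"
      using PiE_mem[OF g] meas by (intro dict_average_measurable[of Q]) (auto simp: mem_Times_iff)
    moreover have "(\<lambda>x. \<Sum>k\<in>Q. a k * \<psi> k x) \<in> borel_measurable M"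
      using meas by (intro borel_measurable_sum borel_measurable_times) auto
    ultimately show ?thesis unfolding e_def[abs_def] by simp
  qed
  have Xs: "X \<in> sets M" unfolding X_def using em by measurable
  define c where "c = exp (8 * l\<^sup>2 * real s)"
  have c0: "0 < c" by (simp add: c_def)
  have hge: "c \<le> ?h x" if "x \<in> X" for x
  proof -
    have "8 * l\<^sup>2 * real s = l * (real s / A * \<epsilon>) / 2"
      using A by (simp add: l_def field_simps power2_eq_square)
    also have "\<dots> \<le> l * (real s / A * norm (e x)) / 2"
      using that l A by (intro divide_right_mono mult_left_mono) (auto simp: X_def)
    also have "real s / A * norm (e x) = norm (of_real (real s / A) * e x)"
      using A unfolding norm_mult norm_of_real by simp
    finally have "c \<le> exp (l * norm (of_real (real s / A) * e x) / 2)" by (simp add: c_def)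
    also have "\<dots> \<le> ?h x" unfolding e_def[symmetric] using l by (intro exp_norm_le_exp_gauge) auto
    finally show ?thesis .
  qed
  have b: "8 * exp (4 * l\<^sup>2 * real s) / c = 8 * exp (- real s * \<epsilon>\<^sup>2 / (64 * A\<^sup>2))"
  proof -
    have "4 * l\<^sup>2 * real s - 8 * l\<^sup>2 * real s = - real s * \<epsilon>\<^sup>2 / (64 * A\<^sup>2)"
      by (simp add: l_def power_divide power_mult_distrib)
    then show ?thesis unfolding c_def by (metis exp_diff times_divide_eq_right)
  qed
  have "c * measure M X = (\<integral>x. c * indicat_real X x \<partial>M)"
    using Xs by (simp add: X_def)
  also have "\<dots> \<le> (\<integral>x. ?h x \<partial>M)"
    using hge Xs by (intro integral_mono int integrable_mult_right integrable_real_indicator)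
      (auto simp: emeasure_eq_measure indicator_def exp_gauge_nonneg)
  finally have "measure M X \<le> 8 * exp (4 * l\<^sup>2 * real s) / c"
    using le1 c0 by (simp add: field_simps)
  moreover have "(\<Sum>j<m. indicat_real X (\<xi> j)) / real m \<le> 8 * exp (4 * l\<^sup>2 * real s) / c"
    using hge le2 c0 by (intro sum_indicat_markov[where h="?h"]) (auto simp: exp_gauge_nonneg)
  ultimately show ?thesis
    using g Xs by (intro that[of g X]) (auto simp: b X_def e_def)
qed

text \<open>The largest level T below y satisfies y < 2 T, so 4 T^2 alone dominates y^2. Values
  below the lowest level 1/2 go into the constant 1/4, which is affordable for functions of unit L_2
  norm.\<close>

lemma dyadic_layers_upper:
  fixes y :: real
  assumes "0 \<le> y" "y < 2^L / 2"
  shows "y\<^sup>2 \<le> 1/4 + 4 * (\<Sum>i<L. if 2^i/2 \<le> y then (2^i/2)\<^sup>2 else 0)"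
  using assms(2)
proof (induction L)
  case 0
  then have "y\<^sup>2 \<le> (1/2)\<^sup>2" using assms(1) by (intro power_mono) auto
  then show ?case by (simp add: power2_eq_square)
next
  case (Suc L)
  show ?case
  proof (cases "2^L/2 \<le> y")
    case True
    have "y\<^sup>2 \<le> (2 * (2^L/2))\<^sup>2" using Suc.prems assms(1) by (intro power_mono) auto
    also have "\<dots> = 4 * (2^L/2)\<^sup>2" by (simp add: power2_eq_square)
    finally have "y\<^sup>2 \<le> 4 * (2^L/2)\<^sup>2" .
    moreover have "0 \<le> (\<Sum>i<L. if 2^i/2 \<le> y then (2^i/2)\<^sup>2 else (0::real))" by (intro sum_nonneg) auto
    ultimately show ?thesis using True by simp
  next
    case False
    then show ?thesis using Suc.IH by simp
  qed
qed

text \<open>The squares of the levels quadruple, so the largest level below y controls the whole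
  sum. Together with the upper bound this lets two measures be compared one level at a time.\<close>

lemma dyadic_layers_lower:
  fixes y :: real
  shows "(\<Sum>i<L. if 2^i/2 \<le> y then (2^i/2)\<^sup>2 else (0::real)) \<le> 4/3 * y\<^sup>2"
proof (induction L)
  case (Suc L)
  show ?case
  proof (cases "2^L/2 \<le> y")
    case True
    have geo: "(\<Sum>i<n. (2^i/2)\<^sup>2) \<le> (1/3) * (2^n/2 :: real)\<^sup>2" for n
      by (induction n) (auto simp: power2_eq_square)
    have "(\<Sum>i<Suc L. if 2^i/2 \<le> y then (2^i/2)\<^sup>2 else (0::real)) \<le> (\<Sum>i<Suc L. (2^i/2)\<^sup>2)"
      by (intro sum_mono) auto
    also have "\<dots> \<le> 1/3 * (2^(Suc L)/2)\<^sup>2" by (rule geo)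
    also have "\<dots> = 4/3 * (2^L/2)\<^sup>2" by (simp add: power2_eq_square)
    also have "\<dots> \<le> 4/3 * y\<^sup>2" using True by (intro mult_left_mono power_mono) auto
    finally show ?thesis .
  qed (use Suc.IH in simp)
qed simp

section \<open>One-sided sampling discretization\<close>

lemma sum_abs_Re_Im_le:
  fixes a :: "'i \<Rightarrow> complex"
  shows "(\<Sum>k\<in>S. \<bar>Re (a k)\<bar> + \<bar>Im (a k)\<bar>) \<le> 2 * (\<Sum>k\<in>S. norm (a k))"
  unfolding sum_distrib_left
  by (intro sum_mono) (smt (verit) abs_Re_le_cmod abs_Im_le_cmod)

text \<open>The three factors next to A^2 in the bound on \<open>m\<close> have separate origins:
  \<open>L\<close> because each level may waste only a 1/L share of the norm, the first logarithm
  because the averages must be accurate off a set of measure about 1/(L A^2), the second because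
  each draw of an average has 5 * card Q outcomes.\<close>

lemma sampling_discretization_sparse:
  fixes \<psi> :: "'i \<Rightarrow> 'a \<Rightarrow> complex"
  assumes M: "prob_space M" and Q: "finite Q" "Q \<noteq> {}"
    and \<psi>: "\<And>k x. k \<in> Q \<Longrightarrow> x \<in> space M \<Longrightarrow> norm (\<psi> k x) \<le> 1"
    and meas: "\<And>k. k \<in> Q \<Longrightarrow> \<psi> k \<in> borel_measurable M"
    and bessel: "\<And>S a. S \<subseteq> Q \<Longrightarrow> (\<Sum>k\<in>S. (norm (a k))\<^sup>2) \<le> K * (\<integral>x. (norm (\<Sum>k\<in>S. a k * \<psi> k x))\<^sup>2 \<partial>M)"
    and K: "0 \<le> K" and A: "1 \<le> A" "4 * real u * K \<le> A\<^sup>2" and L: "2 * A < 2 ^ L"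
    and m: "300000 * real L * A\<^sup>2 * ln (2048 * real L * A\<^sup>2) * ln (5 * real (card Q)) \<le> real m"
  shows "\<exists>\<xi>. (\<forall>j<m. \<xi> j \<in> space M) \<and> (\<forall>S a. S \<subseteq> Q \<and> card S \<le> u \<longrightarrow>
     (\<integral>x. (norm (\<Sum>k\<in>S. a k * \<psi> k x))\<^sup>2 \<partial>M) \<le> 400 * ((\<Sum>j<m. (norm (\<Sum>k\<in>S. a k * \<psi> k (\<xi> j)))\<^sup>2) / real m))"
proof -
  interpret prob_space M by (rule M)
  define \<Lambda> where "\<Lambda> = ln (2048 * real L * A\<^sup>2)"
  define N where "N = real (card Q)"
  have N: "1 \<le> N" using Q by (simp add: N_def Suc_le_eq card_gt_0_iff)
  have L1: "1 \<le> real L" using A L by (cases L) auto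
  have A2: "1 \<le> A\<^sup>2" using A by simp
  have LA: "1 \<le> real L * A\<^sup>2" using mult_mono[OF L1 A2] by simp
  have e3: "exp 1 \<le> (3::real)" by (rule exp_le)
  have \<Lambda>1: "1 \<le> \<Lambda>" unfolding \<Lambda>_def using LA e3 by (subst ln_ge_iff) auto
  have lnN: "1 \<le> ln (5 * N)" using N e3 by (subst ln_ge_iff) auto
  have ln2L: "ln (2 * real L) \<le> \<Lambda>"
    unfolding \<Lambda>_def using L1 A2 LA by (subst ln_le_cancel_iff) (auto intro!: mult_mono[of _ _ 1 "A\<^sup>2", simplified] mult_mono)
  have m0: "0 < m"
  proof (rule ccontr)
    assume "\<not> 0 < m"
    moreover have "0 < 300000 * real L * A\<^sup>2 * ln (2048 * real L * A\<^sup>2) * ln (5 * real (card Q))"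
      using L1 A2 \<Lambda>1 lnN unfolding \<Lambda>_def N_def by (intro mult_pos_pos) auto
    ultimately show False using m by simp
  qed
  define T where "T i = (2::real) ^ i / 2" for i :: nat
  have T0: "0 < T i" for i by (simp add: T_def)
  \<comment> \<open>Level sets of measure below \<tau> i may be lost: over all L levels the loss
    adds up to 1/16, that is 1/4 after the factor 4 of \<open>dyadic_layers_upper\<close>.\<close>
  define \<tau> where "\<tau> i = 1 / (16 * real L * (T i)\<^sup>2)" for i
  have \<tau>0: "0 < \<tau> i" for i using L1 T0[of i] by (simp add: \<tau>_def)
  define R where "R i = A\<^sup>2 / (T i)\<^sup>2" for i
  \<comment> \<open>At precision T i / 4 the exponent of \<open>sparse_approximation_tail\<close> is
    s T^2 / (1024 A^2), hence at least \<Lambda>. The constant 2048 = 8 * 16 * 16 in \<Lambda> then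
    makes the exceptional set smaller than \<tau> i / 16 when T i <= A.\<close>
  define s where "s i = nat \<lceil>1024 * R i * \<Lambda>\<rceil>" for i
  have R1: "1 \<le> R i" if "T i \<le> A" for i
  proof -
    have "(T i)\<^sup>2 \<le> A\<^sup>2" using that T0[of i] by (intro power_mono) auto
    then show ?thesis using T0[of i] by (simp add: R_def)
  qed
  have s_bounds: "1024 * R i * \<Lambda> \<le> real (s i)" "real (s i) \<le> 1024 * R i * \<Lambda> + 1" for i
  proof -
    have "0 \<le> 1024 * R i * \<Lambda>" using \<Lambda>1 by (simp add: R_def)
    then show "1024 * R i * \<Lambda> \<le> real (s i)" "real (s i) \<le> 1024 * R i * \<Lambda> + 1"
      unfolding s_def by linarith+
  qed
  have s0: "0 < s i" if "T i \<le> A" for i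
  proof -
    have "1 * 1 \<le> R i * \<Lambda>" using R1[OF that] \<Lambda>1 by (intro mult_mono) auto
    then show ?thesis using s_bounds(1)[of i] by (cases "s i") auto
  qed
  define G where "G i = PiE {..<s i} (\<lambda>_. Q \<times> phases)" for i
  have finG: "finite (G i)" for i
    unfolding G_def using Q finite_phases by (intro finite_PiE) auto
  have cardG: "real (card (G i)) = exp (real (s i) * ln (5 * N))" for i
    using N unfolding G_def by (simp add: card_PiE card_cartesian_product card_phases N_def exp_of_nat_mult mult.commute)
  \<comment> \<open>With error below T i / 4, the threshold 3/4 lies between the two level sets of f
    in question: f at least T i forces the average above it, and the average above it forces f to be
    at least T i / 2.\<close>
  define E where "E i g = {x \<in> space M. 3/4 * T i \<le> norm (dict_average \<psi> A (s i) g x)}" for i g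
  have fstG: "fst (g j) \<in> Q" if "g \<in> G i" "j < s i" for g i j
    using PiE_mem[of g "{..<s i}" "\<lambda>_. Q \<times> phases" j] that by (auto simp: G_def mem_Times_iff)
  have Esets: "E i g \<in> sets M" if "g \<in> G i" for i g
  proof -
    have "dict_average \<psi> A (s i) g \<in> borel_measurable M"
      using fstG[OF that] meas by (intro dict_average_measurable[of Q]) auto
    then show ?thesis unfolding E_def by measurable
  qed
  \<comment> \<open>Only sets of measure at least \<tau> i / 2 can be required to be hit, since the
    failure probability is governed by m times the measure. Levels above \<open>A\<close> stay out
    because the functions never reach them.\<close>
  define I where "I = (SIGMA i:{i. i < L \<and> T i \<le> A}. {g \<in> G i. \<tau> i / 2 \<le> measure M (E i g)})"
  define \<E> where "\<E> = (\<lambda>(i, g). E i g) ` I"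
  have finI: "finite I" unfolding I_def using finG by auto
  have small: "(\<Sum>X\<in>\<E>. exp (- real m * measure M X / 8)) < 1"
  proof -
    \<comment> \<open>Of the 1026 units of R * \<Lambda> * ln (5 N) below, 1024 and one for rounding
      up pay for the number of averages, and the last one pays for 1/(2 L), so that all levels
      together stay at 1/2. The constant 300000 exceeds 256 * 1026, where 256 = 16 * 16 comes from
      \<tau> and the exponent.\<close>
    have term_le: "real (card (G i)) * exp (- real m * \<tau> i / 16) \<le> 1 / (2 * real L)" if Ti: "T i \<le> A" for i
    proof -
      have RL: "1 \<le> R i * \<Lambda>" using mult_mono[OF R1[OF Ti] \<Lambda>1] R1[OF Ti] by simp
      have "real (s i) * ln (5 * N) \<le> (1025 * (R i * \<Lambda>)) * ln (5 * N)"
        using s_bounds(2)[of i] RL lnN by (intro mult_right_mono) auto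
      moreover have "ln (2 * real L) \<le> (R i * \<Lambda>) * ln (5 * N)"
      proof -
        have "\<Lambda> * 1 \<le> (R i * \<Lambda>) * ln (5 * N)"
          using R1[OF Ti] \<Lambda>1 lnN by (intro mult_mono) (auto simp: mult_le_cancel_right1)
        then show ?thesis using ln2L by simp
      qed
      moreover have "1026 * (R i * \<Lambda> * ln (5 * N)) \<le> real m * \<tau> i / 16"
      proof -
        have "1026 * (R i * \<Lambda> * ln (5 * N)) \<le> 300000 / 256 * (R i * \<Lambda> * ln (5 * N))"
          using RL lnN by (intro mult_right_mono) auto
        also have "\<dots> = (300000 * real L * A\<^sup>2 * \<Lambda> * ln (5 * N)) * \<tau> i / 16"
          using L1 T0[of i] by (simp add: R_def \<tau>_def)
        also have "\<dots> \<le> real m * \<tau> i / 16"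
          using m \<tau>0[of i] unfolding \<Lambda>_def N_def by (intro divide_right_mono mult_right_mono) auto
        finally show ?thesis .
      qed
      ultimately have "real (s i) * ln (5 * N) + (- real m * \<tau> i / 16) \<le> - ln (2 * real L)"
        by simp
      then have "exp (real (s i) * ln (5 * N) + (- real m * \<tau> i / 16)) \<le> exp (- ln (2 * real L))"
        by simp
      then show ?thesis unfolding exp_add cardG using L1 by (simp add: exp_minus inverse_eq_divide)
    qed
    have "(\<Sum>X\<in>\<E>. exp (- real m * measure M X / 8)) \<le> (\<Sum>(i, g)\<in>I. exp (- real m * measure M (E i g) / 8))"
      unfolding \<E>_def by (rule order_trans[OF sum_image_le[OF finI]]) (auto simp: case_prod_beta o_def)
    also have "\<dots> = (\<Sum>i\<in>{i. i < L \<and> T i \<le> A}. \<Sum>g\<in>{g \<in> G i. \<tau> i / 2 \<le> measure M (E i g)}. exp (- real m * measure M (E i g) / 8))"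
      unfolding I_def using finG by (intro sum.Sigma[symmetric]) auto
    also have "\<dots> \<le> (\<Sum>i\<in>{i. i < L \<and> T i \<le> A}. 1 / (2 * real L))"
    proof (rule sum_mono)
      fix i assume i: "i \<in> {i. i < L \<and> T i \<le> A}"
      have "(\<Sum>g\<in>{g \<in> G i. \<tau> i / 2 \<le> measure M (E i g)}. exp (- real m * measure M (E i g) / 8))
         \<le> (\<Sum>g\<in>{g \<in> G i. \<tau> i / 2 \<le> measure M (E i g)}. exp (- real m * \<tau> i / 16))"
      proof (rule sum_mono)
        fix g assume "g \<in> {g \<in> G i. \<tau> i / 2 \<le> measure M (E i g)}"
        then have "real m * (\<tau> i / 2) \<le> real m * measure M (E i g)" by (intro mult_left_mono) auto
        then show "exp (- real m * measure M (E i g) / 8) \<le> exp (- real m * \<tau> i / 16)" by simp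
      qed
      also have "\<dots> \<le> (\<Sum>g\<in>G i. exp (- real m * \<tau> i / 16))"
        using finG by (intro sum_mono2) auto
      also have "\<dots> \<le> 1 / (2 * real L)" using term_le i by simp
      finally show "(\<Sum>g\<in>{g \<in> G i. \<tau> i / 2 \<le> measure M (E i g)}. exp (- real m * measure M (E i g) / 8)) \<le> 1 / (2 * real L)" .
    qed
    also have "\<dots> \<le> (\<Sum>i<L. 1 / (2 * real L))" by (intro sum_mono2) auto
    also have "\<dots> < 1" using L1 by simp
    finally show ?thesis .
  qed
  have "\<E> \<subseteq> sets M" unfolding \<E>_def I_def using Esets by auto
  moreover have "finite \<E>" unfolding \<E>_def using finI by simp
  ultimately obtain \<xi> where \<xi>: "\<forall>j<m. \<xi> j \<in> space M"
    and count: "\<forall>X\<in>\<E>. 3/8 * real m * measure M X \<le> (\<Sum>j<m. indicat_real X (\<xi> j))"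
    using sampling_points_exist[OF M, of \<E> m] small by auto
  \<comment> \<open>The levels T i are absolute numbers, so the norm has to be 1 first; homogeneity
    gives the rest at the end.\<close>
  have unit: "1 \<le> 400 * ((\<Sum>j<m. (norm (\<Sum>k\<in>S. a k * \<psi> k (\<xi> j)))\<^sup>2) / real m)"
    if S: "S \<subseteq> Q" "card S \<le> u" and n1: "(\<integral>x. (norm (\<Sum>k\<in>S. a k * \<psi> k x))\<^sup>2 \<partial>M) = 1" for S a
  proof -
    define f where "f x = (\<Sum>k\<in>S. a k * \<psi> k x)" for x
    \<comment> \<open>Padding by zeros places every sparse f over the whole of \<open>Q\<close>,
      whose dictionary was fixed before the sample, without changing the coefficient sum.\<close>
    define b where "b k = (if k \<in> S then a k else 0)" for k
    have finS: "finite S" using S Q finite_subset by blast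
    have fb: "f x = (\<Sum>k\<in>Q. b k * \<psi> k x)" for x
      unfolding f_def b_def using S Q by (intro sum.mono_neutral_cong_left) auto
    have fm: "f \<in> borel_measurable M"
      unfolding f_def[abs_def] using S meas by (intro borel_measurable_sum borel_measurable_times) auto
    \<comment> \<open>Cauchy-Schwarz over at most \<open>u\<close> indices and the Bessel inequality
      give the square of the coefficient sum at most K u. The factor 2 pays for splitting moduli
      into real and imaginary parts.\<close>
    have l1: "2 * (\<Sum>k\<in>S. norm (a k)) \<le> A"
    proof (rule power2_le_imp_le)
      have "(\<Sum>k\<in>S. norm (a k))\<^sup>2 \<le> (\<Sum>k\<in>S. (norm (a k))\<^sup>2) * (\<Sum>k\<in>S. 1\<^sup>2)"
        using Cauchy_Schwarz_ineq_sum[of "\<lambda>k. norm (a k)" "\<lambda>_. 1" S] by simp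
      also have "\<dots> \<le> K * real u"
        using bessel[OF S(1), of a] S(2) K n1 by (intro mult_mono) auto
      finally show "(2 * (\<Sum>k\<in>S. norm (a k)))\<^sup>2 \<le> A\<^sup>2"
        using A(2) by (simp add: power_mult_distrib mult.commute)
    qed (use A in simp)
    have bA: "(\<Sum>k\<in>Q. \<bar>Re (b k)\<bar> + \<bar>Im (b k)\<bar>) \<le> A"
    proof -
      have "(\<Sum>k\<in>Q. \<bar>Re (b k)\<bar> + \<bar>Im (b k)\<bar>) = (\<Sum>k\<in>S. \<bar>Re (a k)\<bar> + \<bar>Im (a k)\<bar>)"
        unfolding b_def using S Q by (intro sum.mono_neutral_cong_right) auto
      then show ?thesis using sum_abs_Re_Im_le[of a S] l1 by simp
    qed
    have fA: "norm (f x) < 2 ^ L / 2" "norm (f x) \<le> A" if "x \<in> space M" for x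
    proof -
      have "norm (f x) \<le> (\<Sum>k\<in>S. norm (a k))"
        unfolding f_def using S \<psi> that by (intro order_trans[OF norm_sum] sum_mono) (auto simp: norm_mult intro!: mult_left_le)
      moreover have "0 \<le> (\<Sum>k\<in>S. norm (a k))" by (intro sum_nonneg) auto
      ultimately show "norm (f x) < 2 ^ L / 2" "norm (f x) \<le> A" using l1 L by auto
    qed
    define F where "F i = {x \<in> space M. T i \<le> norm (f x)}" for i
    define H where "H i = {x. T i \<le> 2 * norm (f x)}" for i
    define n where "n i = (\<Sum>j<m. indicat_real (H i) (\<xi> j)) / real m" for i
    have Fs: "F i \<in> sets M" for i unfolding F_def using fm by measurable
    \<comment> \<open>If F i has measure at least \<tau> i, it passes to some E i g up to \<tau> i /
      16, then to the sample with rate 3/8, then to H i up to another \<tau> i / 16. Otherwise, or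
      if i >= L where F i is empty, the bound is immediate.\<close>
    have key: "measure M (F i) \<le> \<tau> i + 8 * n i" for i
    proof (cases "i < L \<and> \<tau> i \<le> measure M (F i)")
      case False
      have "0 \<le> n i" unfolding n_def by (intro divide_nonneg_nonneg sum_nonneg) auto
      moreover have "measure M (F i) \<le> \<tau> i" if "\<not> i < L"
      proof -
        have "F i = {}"
        proof -
          have "(2::real) ^ L / 2 \<le> T i" unfolding T_def using that by (intro divide_right_mono power_increasing) auto
          then show ?thesis unfolding F_def using fA(1) by fastforce
        qed
        then show ?thesis using \<tau>0[of i] by simp
      qed
      ultimately show ?thesis using False by fastforce
    next
      case True
      then have "F i \<noteq> {}" using \<tau>0[of i] by auto
      then have Ti: "T i \<le> A" unfolding F_def using fA(2) by force
      have small\<epsilon>: "0 < T i / 4" "T i / 4 \<le> 8 * A" using T0[of i] Ti by auto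
      obtain g X where g: "g \<in> PiE {..<s i} (\<lambda>_. Q \<times> phases)" and X: "X \<in> sets M"
        and close: "\<And>x. x \<in> space M \<Longrightarrow> x \<notin> X \<Longrightarrow> norm (dict_average \<psi> A (s i) g x - (\<Sum>k\<in>Q. b k * \<psi> k x)) < T i / 4"
        and X1: "measure M X \<le> 8 * exp (- real (s i) * (T i / 4)\<^sup>2 / (64 * A\<^sup>2))"
        and X2: "(\<Sum>j<m. indicat_real X (\<xi> j)) / real m \<le> 8 * exp (- real (s i) * (T i / 4)\<^sup>2 / (64 * A\<^sup>2))"
        by (rule sparse_approximation_tail[OF M Q _ _ _ bA _ m0 s0[OF Ti] small\<epsilon>, where \<psi>=\<psi> and \<xi>=\<xi>])
          (use \<psi> meas \<xi> A in auto)
      have \<eta>: "8 * exp (- real (s i) * (T i / 4)\<^sup>2 / (64 * A\<^sup>2)) \<le> \<tau> i / 16"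
      proof -
        have "\<Lambda> = 1024 * R i * \<Lambda> * ((T i / 4)\<^sup>2 / (64 * A\<^sup>2))"
          using T0[of i] A by (simp add: R_def power_divide)
        also have "\<dots> \<le> real (s i) * ((T i / 4)\<^sup>2 / (64 * A\<^sup>2))"
          by (intro mult_right_mono s_bounds) auto
        finally have "exp (- real (s i) * (T i / 4)\<^sup>2 / (64 * A\<^sup>2)) \<le> exp (- \<Lambda>)" by simp
        also have "\<dots> = 1 / (2048 * real L * A\<^sup>2)"
          unfolding \<Lambda>_def using LA by (simp add: exp_minus inverse_eq_divide)
        also have "\<dots> \<le> 1 / (2048 * real L * (T i)\<^sup>2)"
          using L1 A T0[of i] Ti by (intro divide_left_mono mult_left_mono power_mono mult_pos_pos) auto
        finally show ?thesis by (simp add: \<tau>_def)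
      qed
      have gG: "g \<in> G i" using g by (simp add: G_def)
      have near: "norm (f x) - T i / 4 < norm (dict_average \<psi> A (s i) g x)" "norm (dict_average \<psi> A (s i) g x) < norm (f x) + T i / 4"
        if "x \<in> space M" "x \<notin> X" for x
        using close[OF that] norm_triangle_ineq2[of "f x" "dict_average \<psi> A (s i) g x"]
          norm_triangle_ineq2[of "dict_average \<psi> A (s i) g x" "f x"]
        unfolding fb[symmetric] norm_minus_commute[of "f x"] by linarith+
      have "F i \<subseteq> E i g \<union> X"
      proof
        fix x assume x: "x \<in> F i"
        show "x \<in> E i g \<union> X"
        proof (cases "x \<in> X")
          case False
          then show ?thesis using x near(1)[of x] by (auto simp: F_def E_def)
        qed simp
      qed
      then have "measure M (F i) \<le> measure M (E i g \<union> X)"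
        using Esets[OF gG] X by (intro finite_measure_mono) auto
      also have "\<dots> \<le> measure M (E i g) + measure M X"
        using Esets[OF gG] X by (intro measure_Un_le) auto
      finally have EF: "measure M (F i) - \<tau> i / 16 \<le> measure M (E i g)" using X1 \<eta> by linarith
      \<comment> \<open>At least 15/16 of \<tau> i is left, so this set passed the threshold \<tau>
        i / 2 and the sample was chosen with it in view.\<close>
      then have "E i g \<in> \<E>"
        unfolding \<E>_def I_def using gG Ti True \<tau>0[of i] by (intro image_eqI[of _ _ "(i, g)"]) auto
      then have "3/8 * real m * measure M (E i g) \<le> (\<Sum>j<m. indicat_real (E i g) (\<xi> j))" using count by blast
      also have "\<dots> \<le> (\<Sum>j<m. indicat_real (H i) (\<xi> j) + indicat_real X (\<xi> j))"
      proof (rule sum_mono)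
        fix j assume "j \<in> {..<m}"
        then have "\<xi> j \<in> space M" using \<xi> by auto
        then have "\<xi> j \<in> E i g \<Longrightarrow> \<xi> j \<notin> X \<Longrightarrow> \<xi> j \<in> H i"
          using near(2)[of "\<xi> j"] by (auto simp: E_def H_def)
        then show "indicat_real (E i g) (\<xi> j) \<le> indicat_real (H i) (\<xi> j) + indicat_real X (\<xi> j)"
          by (auto simp: indicator_def)
      qed
      finally have "(3/8 * real m * measure M (E i g)) / real m \<le> n i + (\<Sum>j<m. indicat_real X (\<xi> j)) / real m"
        unfolding n_def sum.distrib add_divide_distrib[symmetric] by (intro divide_right_mono) auto
      then have "3/8 * measure M (E i g) \<le> n i + \<tau> i / 16" using m0 X2 \<eta> by simp
      then show ?thesis using EF \<tau>0[of i] True by argo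
    qed
    have "1 = (\<integral>x. (norm (f x))\<^sup>2 \<partial>M)" unfolding f_def n1 ..
    also have "\<dots> \<le> (\<integral>x. 1/4 + 4 * (\<Sum>i<L. (T i)\<^sup>2 * indicat_real (F i) x) \<partial>M)"
    proof (intro integral_mono)
      show "integrable M (\<lambda>x. (norm (f x))\<^sup>2)"
      proof (rule integrable_const_bound)
        show "AE x in M. norm ((norm (f x))\<^sup>2) \<le> A\<^sup>2"
          using fA(2) by (intro AE_I2) (auto intro!: power_mono)
      qed (use fm in measurable)
      show "integrable M (\<lambda>x. 1/4 + 4 * (\<Sum>i<L. (T i)\<^sup>2 * indicat_real (F i) x))"
        using Fs by (intro Bochner_Integration.integrable_add integrable_mult_right Bochner_Integration.integrable_sum integrable_const integrable_real_indicator)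
          (auto simp: emeasure_eq_measure)
      fix x assume x: "x \<in> space M"
      have "(T i)\<^sup>2 * indicat_real (F i) x = (if 2^i/2 \<le> norm (f x) then (2^i/2)\<^sup>2 else 0)" for i
        using x by (auto simp: F_def T_def)
      then show "(norm (f x))\<^sup>2 \<le> 1/4 + 4 * (\<Sum>i<L. (T i)\<^sup>2 * indicat_real (F i) x)"
        using dyadic_layers_upper[OF _ fA(1)[OF x]] by simp
    qed
    also have "\<dots> = 1/4 + 4 * (\<Sum>i<L. (T i)\<^sup>2 * measure M (F i))"
    proof -
      have iF: "integrable M (\<lambda>x. (T i)\<^sup>2 * indicat_real (F i) x)" for i
        using Fs by (intro integrable_mult_right integrable_real_indicator) (auto simp: emeasure_eq_measure)
      have "(\<integral>x. (T i)\<^sup>2 * indicat_real (F i) x \<partial>M) = (T i)\<^sup>2 * measure M (F i)" for i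
        using Fs[of i] by (simp add: sets.sets_into_space[THEN Int_absorb1])
      then have "(\<integral>x. (\<Sum>i<L. (T i)\<^sup>2 * indicat_real (F i) x) \<partial>M) = (\<Sum>i<L. (T i)\<^sup>2 * measure M (F i))"
        by (simp only: Bochner_Integration.integral_sum[OF iF])
      moreover have "integrable M (\<lambda>x. \<Sum>i<L. (T i)\<^sup>2 * indicat_real (F i) x)"
        by (rule Bochner_Integration.integrable_sum[OF iF])
      ultimately show ?thesis
        by (subst Bochner_Integration.integral_add) (auto simp: prob_space simp del: sum_mult_indicator)
    qed
    also have "(\<Sum>i<L. (T i)\<^sup>2 * measure M (F i)) \<le> (\<Sum>i<L. 1 / (16 * real L) + 8 * ((T i)\<^sup>2 * n i))"
    proof (rule sum_mono)
      fix i
      have "(T i)\<^sup>2 * measure M (F i) \<le> (T i)\<^sup>2 * (\<tau> i + 8 * n i)" by (intro mult_left_mono key) auto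
      also have "\<dots> = 1 / (16 * real L) + 8 * ((T i)\<^sup>2 * n i)"
        using T0[of i] by (simp add: \<tau>_def field_simps)
      finally show "(T i)\<^sup>2 * measure M (F i) \<le> 1 / (16 * real L) + 8 * ((T i)\<^sup>2 * n i)" .
    qed
    also have "\<dots> = 1/16 + 8 * (\<Sum>i<L. (T i)\<^sup>2 * n i)"
      using L1 by (simp add: sum.distrib sum_distrib_left)
    also have "(\<Sum>i<L. (T i)\<^sup>2 * n i) = (\<Sum>j<m. \<Sum>i<L. (T i)\<^sup>2 * indicat_real (H i) (\<xi> j)) / real m"
      unfolding n_def by (subst sum.swap) (simp only: sum_distrib_left sum_divide_distrib times_divide_eq_right)
    also have "\<dots> \<le> (\<Sum>j<m. 16/3 * (norm (f (\<xi> j)))\<^sup>2) / real m"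
    proof (intro divide_right_mono sum_mono)
      fix j
      have "(T i)\<^sup>2 * indicat_real (H i) (\<xi> j) = (if 2^i/2 \<le> 2 * norm (f (\<xi> j)) then (2^i/2)\<^sup>2 else 0)" for i
        by (auto simp: H_def T_def)
      then show "(\<Sum>i<L. (T i)\<^sup>2 * indicat_real (H i) (\<xi> j)) \<le> 16/3 * (norm (f (\<xi> j)))\<^sup>2"
        using dyadic_layers_lower[where L=L and y="2 * norm (f (\<xi> j))"] by (simp add: power_mult_distrib)
    qed simp
    also have "\<dots> = 16/3 * ((\<Sum>j<m. (norm (f (\<xi> j)))\<^sup>2) / real m)"
      by (simp only: sum_distrib_left[symmetric] times_divide_eq_right)
    \<comment> \<open>The known terms sum to 1/2 and the discrete norm has the factor 4 * 8 * 16/3 =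
      512/3, so it is at least 3/1024, more than 1/400. Here 16/3 is 4/3 times the square of the 2
      in \<open>H\<close>.\<close>
    finally have "1 \<le> 1/4 + 4 * (1/16 + 8 * (16/3 * ((\<Sum>j<m. (norm (f (\<xi> j)))\<^sup>2) / real m)))" by simp
    moreover have "0 \<le> (\<Sum>j<m. (norm (f (\<xi> j)))\<^sup>2) / real m" by (intro divide_nonneg_nonneg sum_nonneg) auto
    ultimately show ?thesis unfolding f_def[symmetric] by argo
  qed
  have "(\<integral>x. (norm (\<Sum>k\<in>S. a k * \<psi> k x))\<^sup>2 \<partial>M) \<le> 400 * ((\<Sum>j<m. (norm (\<Sum>k\<in>S. a k * \<psi> k (\<xi> j)))\<^sup>2) / real m)"
    if S: "S \<subseteq> Q" "card S \<le> u" for S a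
  proof -
    define c where "c = (\<integral>x. (norm (\<Sum>k\<in>S. a k * \<psi> k x))\<^sup>2 \<partial>M)"
    have nn: "0 \<le> (\<Sum>j<m. (norm (\<Sum>k\<in>S. a k * \<psi> k (\<xi> j)))\<^sup>2) / real m"
      by (intro divide_nonneg_nonneg sum_nonneg) auto
    have c0: "0 \<le> c" unfolding c_def by (intro Bochner_Integration.integral_nonneg) auto
    show ?thesis
    proof (cases "c = 0")
      case True
      then show ?thesis using nn unfolding c_def by simp
    next
      case False
      then have c: "0 < c" using c0 by simp
      have scale: "(norm (\<Sum>k\<in>S. (of_real (1 / sqrt c) * a k) * \<psi> k x))\<^sup>2 = (norm (\<Sum>k\<in>S. a k * \<psi> k x))\<^sup>2 / c" for x
      proof -
        have "(\<Sum>k\<in>S. (of_real (1 / sqrt c) * a k) * \<psi> k x) = of_real (1 / sqrt c) * (\<Sum>k\<in>S. a k * \<psi> k x)"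
          by (simp add: sum_distrib_left mult.assoc)
        then show ?thesis using c by (simp add: norm_mult norm_divide power_divide)
      qed
      have "1 \<le> 400 * ((\<Sum>j<m. (norm (\<Sum>k\<in>S. (of_real (1 / sqrt c) * a k) * \<psi> k (\<xi> j)))\<^sup>2) / real m)"
        by (rule unit[OF S]) (unfold scale, use c in \<open>simp add: c_def\<close>)
      also have "\<dots> = 400 * ((\<Sum>j<m. (norm (\<Sum>k\<in>S. a k * \<psi> k (\<xi> j)))\<^sup>2) / real m) / c"
        unfolding scale by (simp add: sum_divide_distrib[symmetric])
      finally show ?thesis by (simp only: c_def[symmetric] le_divide_eq_1_pos[OF c])
    qed
  qed
  then show ?thesis using \<xi> by blast
qed

section \<open>Coefficient classes\<close>

lemma norm_component_le_linf_int: "\<bar>k $ i\<bar> \<le> linf_int k"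
  unfolding linf_int_def by (rule Max_ge) auto

lemma linf_int_nonneg: "0 \<le> linf_int k"
  using norm_component_le_linf_int[of k undefined] by linarith

text \<open>Cutting at powers of 2 makes the cube the union of the blocks up to \<open>n\<close>, so
  tails of the class are sums over later blocks.\<close>

definition int_box :: "nat \<Rightarrow> (int ^ 'd) set" where
  "int_box n = {k. linf_int k < 2 ^ n}"

lemma finite_int_box: "finite (int_box n :: (int ^ 'd) set)"
  and card_int_box: "card (int_box n :: (int ^ 'd) set) \<le> 2 ^ ((n + 1) * CARD('d))"
proof -
  let ?A = "{- (2 ^ n) <..< 2 ^ n} :: int set"
  let ?P = "PiE (UNIV :: 'd set) (\<lambda>_. ?A)"
  have inj: "inj_on (\<lambda>k::int ^ 'd. ($) k) (int_box n)" by (auto simp: inj_on_def vec_eq_iff)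
  have sub: "(\<lambda>k::int ^ 'd. ($) k) ` int_box n \<subseteq> ?P"
  proof clarify
    fix k :: "int ^ 'd" assume "k \<in> int_box n"
    then have "\<bar>k $ i\<bar> < 2 ^ n" for i
      using norm_component_le_linf_int[of k i] by (simp add: int_box_def)
    then show "($) k \<in> ?P" by (auto simp: PiE_UNIV_domain abs_less_iff) (smt (verit))
  qed
  have finP: "finite ?P" by (intro finite_PiE) auto
  show "finite (int_box n :: (int ^ 'd) set)"
    using inj_on_finite[OF inj sub finP] .
  have "card (int_box n :: (int ^ 'd) set) \<le> card ?P"
    using card_inj_on_le[OF inj sub finP] .
  also have "\<dots> = card ?A ^ CARD('d)" by (simp add: card_PiE)
  also have "\<dots> \<le> (2 ^ (n + 1)) ^ CARD('d)" by (intro power_mono) (auto simp: nat_le_iff)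
  finally show "card (int_box n :: (int ^ 'd) set) \<le> 2 ^ ((n + 1) * CARD('d))"
    by (simp only: power_mult)
qed

lemma dyadic_block_subset_int_box: "dyadic_block j \<subseteq> int_box j"
  by (auto simp: dyadic_block_def int_box_def)

lemma finite_dyadic_block: "finite (dyadic_block j)"
  using finite_subset[OF dyadic_block_subset_int_box finite_int_box] .

lemma int_box_cover: "k \<in> int_box n \<Longrightarrow> \<exists>j\<le>n. k \<in> dyadic_block j"
proof (induction n)
  case 0
  then show ?case using linf_int_nonneg[of k] by (auto simp: int_box_def dyadic_block_def)
next
  case (Suc n)
  show ?case
  proof (cases "k \<in> int_box n")
    case True
    then show ?thesis using Suc.IH le_SucI by blast
  next
    case False
    then have "k \<in> dyadic_block (Suc n)" using Suc.prems by (simp add: int_box_def dyadic_block_def)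
    then show ?thesis by blast
  qed
qed

lemma int_box_exhaust: "\<exists>n. k \<in> int_box n"
proof -
  have "linf_int k < 2 ^ nat (linf_int k)"
    using linf_int_nonneg[of k] of_nat_less_two_power[of "nat (linf_int k)", where 'a=int] by simp
  then show ?thesis by (auto simp: int_box_def)
qed

lemma int_box_mono: "m \<le> n \<Longrightarrow> int_box m \<subseteq> int_box n"
  by (auto simp: int_box_def intro: less_le_trans power_increasing)

lemma sum_le_sum_cover:
  fixes h :: "'a \<Rightarrow> real"
  assumes "finite F" "finite J" and cover: "\<And>k. k \<in> F \<Longrightarrow> \<exists>j\<in>J. k \<in> B j" and h: "\<And>k. k \<in> F \<Longrightarrow> 0 \<le> h k"
  shows "sum h F \<le> (\<Sum>j\<in>J. \<Sum>k\<in>{k \<in> F. k \<in> B j}. h k)"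
proof -
  have "h k \<le> (\<Sum>j\<in>J. if k \<in> B j then h k else 0)" if k: "k \<in> F" for k
  proof -
    obtain j where j: "j \<in> J" "k \<in> B j" using cover[OF k] by blast
    show ?thesis
      using member_le_sum[OF j(1), of "\<lambda>j. if k \<in> B j then h k else 0"] j(2) h[OF k] assms(2) by auto
  qed
  then have "sum h F \<le> (\<Sum>k\<in>F. \<Sum>j\<in>J. if k \<in> B j then h k else 0)" by (rule sum_mono)
  also have "\<dots> = (\<Sum>j\<in>J. \<Sum>k\<in>F. if k \<in> B j then h k else 0)" by (rule sum.swap)
  also have "\<dots> = (\<Sum>j\<in>J. \<Sum>k\<in>{k \<in> F. k \<in> B j}. h k)"
    using assms(1) by (simp add: sum.inter_filter)
  finally show ?thesis .
qed

lemma geometric_tail_le: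
  fixes q :: real
  assumes "0 < q" "q < 1"
  shows "(\<Sum>j<m. if j \<le> n then 0 else q ^ j) \<le> q ^ (n + 1) / (1 - q)"
proof -
  \<comment> \<open>The exact value, with \<open>max\<close> covering the range where all terms
    vanish, is what induction on \<open>m\<close> can carry.\<close>
  have "(1 - q) * (\<Sum>j<m. if j \<le> n then 0 else q ^ j) = q ^ (n + 1) - q ^ max m (n + 1)"
  proof (induction m)
    case (Suc m)
    have "(1 - q) * (\<Sum>j<Suc m. if j \<le> n then 0 else q ^ j) = q ^ (n + 1) - q ^ max m (n + 1) + (1 - q) * (if m \<le> n then 0 else q ^ m)"
      unfolding Suc.IH[symmetric] by (simp add: distrib_left)
    also have "\<dots> = q ^ (n + 1) - q ^ max (Suc m) (n + 1)"
      by (cases "m \<le> n"; cases "m = Suc n") (auto simp: max_def algebra_simps)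
    finally show ?case .
  qed simp
  also have "\<dots> \<le> q ^ (n + 1)" using assms by simp
  finally show ?thesis using assms by (simp add: field_simps)
qed

lemma powr_base_power: "0 < (x::real) \<Longrightarrow> x powr (c * real j) = (x powr c) ^ j"
  by (simp add: powr_powr[symmetric] powr_realpow)

section \<open>Coefficient estimates for one function of the class\<close>

context
  fixes r \<beta> :: real and a :: "int ^ 'd \<Rightarrow> complex"
  assumes \<beta>: "0 < \<beta>" "\<beta> \<le> 1" and r: "0 < r"
    and blk: "\<And>j::nat. (\<Sum>k\<in>dyadic_block j. (norm (a k)) powr \<beta>) powr (1 / \<beta>) \<le> 2 powr (- r * real j)"
begin

lemma block_powr_sum_le: "(\<Sum>k\<in>dyadic_block j. (norm (a k)) powr \<beta>) \<le> (2 powr (- r * \<beta>)) ^ j"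
proof -
  let ?s = "\<Sum>k\<in>dyadic_block j. (norm (a k)) powr \<beta>"
  have s0: "0 \<le> ?s" by (intro sum_nonneg) auto
  have "(?s powr (1 / \<beta>)) powr \<beta> \<le> (2 powr (- r * real j)) powr \<beta>"
    using blk \<beta> by (intro powr_mono2) auto
  then have "?s \<le> 2 powr ((- r * \<beta>) * real j)"
    using s0 \<beta> by (simp add: powr_powr mult_ac)
  then show ?thesis by (simp only: powr_base_power zero_less_numeral)
qed

text \<open>Below the threshold, |a| <= \<epsilon>^(1-\<beta>) |a|^\<beta>. The bound is written as
  \<epsilon> times the one in \<open>block_large_card_le\<close>, so that a single count controls
  both the number of large coefficients and the sum of the small ones.\<close>

lemma block_small_sum_le:
  assumes \<epsilon>: "0 < \<epsilon>"
  shows "(\<Sum>k\<in>{k \<in> dyadic_block j. norm (a k) \<le> \<epsilon>}. norm (a k)) \<le> \<epsilon> * (\<epsilon> powr (- \<beta>) * (2 powr (- r * \<beta>)) ^ j)"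
proof -
  let ?B = "{k \<in> dyadic_block j. norm (a k) \<le> \<epsilon>}"
  have "(\<Sum>k\<in>?B. norm (a k)) \<le> (\<Sum>k\<in>?B. \<epsilon> powr (1 - \<beta>) * norm (a k) powr \<beta>)"
  proof (rule sum_mono)
    fix k assume k: "k \<in> ?B"
    have "norm (a k) = norm (a k) powr ((1 - \<beta>) + \<beta>)" by simp
    also have "\<dots> = norm (a k) powr (1 - \<beta>) * norm (a k) powr \<beta>" by (rule powr_add)
    also have "\<dots> \<le> \<epsilon> powr (1 - \<beta>) * norm (a k) powr \<beta>"
      using k \<beta> by (intro mult_right_mono powr_mono2) auto
    finally show "norm (a k) \<le> \<epsilon> powr (1 - \<beta>) * norm (a k) powr \<beta>" .
  qed
  also have "\<dots> = \<epsilon> powr (1 - \<beta>) * (\<Sum>k\<in>?B. norm (a k) powr \<beta>)" by (rule sum_distrib_left[symmetric])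
  also have "\<dots> \<le> \<epsilon> powr (1 - \<beta>) * (\<Sum>k\<in>dyadic_block j. norm (a k) powr \<beta>)"
    by (intro mult_left_mono sum_mono2 finite_dyadic_block) auto
  also have "\<dots> \<le> \<epsilon> powr (1 - \<beta>) * (2 powr (- r * \<beta>)) ^ j"
    by (intro mult_left_mono block_powr_sum_le) auto
  also have "\<epsilon> powr (1 - \<beta>) = \<epsilon> * \<epsilon> powr (- \<beta>)"
    using \<epsilon> by (simp add: powr_diff powr_minus divide_inverse)
  finally show ?thesis by (simp add: mult.assoc)
qed

lemma block_large_card_le:
  assumes \<epsilon>: "0 < \<epsilon>"
  shows "real (card {k \<in> dyadic_block j. \<epsilon> < norm (a k)}) \<le> \<epsilon> powr (- \<beta>) * (2 powr (- r * \<beta>)) ^ j"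
proof -
  let ?B = "{k \<in> dyadic_block j. \<epsilon> < norm (a k)}"
  have "real (card ?B) * \<epsilon> powr \<beta> = (\<Sum>k\<in>?B. \<epsilon> powr \<beta>)" by simp
  also have "\<dots> \<le> (\<Sum>k\<in>?B. norm (a k) powr \<beta>)" using \<epsilon> \<beta> by (intro sum_mono powr_mono2) auto
  also have "\<dots> \<le> (\<Sum>k\<in>dyadic_block j. norm (a k) powr \<beta>)"
    by (intro sum_mono2 finite_dyadic_block) auto
  also have "\<dots> \<le> (2 powr (- r * \<beta>)) ^ j" by (rule block_powr_sum_le)
  finally show ?thesis using \<epsilon> by (simp add: powr_minus field_simps)
qed

lemma block_l1_le: "(\<Sum>k\<in>dyadic_block j. norm (a k)) \<le> (2 powr (- r)) ^ j"
proof -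
  \<comment> \<open>This threshold bounds every coefficient of the block, so the estimate for small
    coefficients covers the block entirely.\<close>
  define \<epsilon> where "\<epsilon> = 2 powr (- r * real j)"
  have "norm (a k) \<le> \<epsilon>" if k: "k \<in> dyadic_block j" for k
  proof -
    have "norm (a k) powr \<beta> \<le> (\<Sum>k\<in>dyadic_block j. norm (a k) powr \<beta>)"
      by (rule member_le_sum[OF k]) (auto simp: finite_dyadic_block)
    then have "(norm (a k) powr \<beta>) powr (1 / \<beta>) \<le> (\<Sum>k\<in>dyadic_block j. norm (a k) powr \<beta>) powr (1 / \<beta>)"
      using \<beta> by (intro powr_mono2) auto
    then show ?thesis using blk[of j] \<beta> by (simp add: powr_powr \<epsilon>_def)
  qed
  then have "{k \<in> dyadic_block j. norm (a k) \<le> \<epsilon>} = dyadic_block j" by auto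
  then have "(\<Sum>k\<in>dyadic_block j. norm (a k)) \<le> \<epsilon> * (\<epsilon> powr (- \<beta>) * (2 powr (- r * \<beta>)) ^ j)"
    using block_small_sum_le[of \<epsilon> j] by (simp add: \<epsilon>_def)
  also have "(2 powr (- r * \<beta>)) ^ j = \<epsilon> powr \<beta>"
    unfolding \<epsilon>_def by (simp add: powr_powr powr_base_power[symmetric] mult_ac)
  also have "\<epsilon> * (\<epsilon> powr (- \<beta>) * \<epsilon> powr \<beta>) = \<epsilon>"
    by (simp add: powr_add[symmetric] \<epsilon>_def)
  also have "\<epsilon> = (2 powr (- r)) ^ j" unfolding \<epsilon>_def by (rule powr_base_power) simp
  finally show ?thesis .
qed

lemma tail_l1_le:
  assumes F: "finite F" "F \<inter> int_box J = {}"
  shows "(\<Sum>k\<in>F. norm (a k)) \<le> (2 powr (- r)) ^ J / (1 - 2 powr (- r))"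
proof -
  define p where "p = 2 powr (- r)"
  have p: "0 < p" "p < 1" using r by (auto simp: p_def powr_less_one)
  obtain n where n: "\<And>k. k \<in> F \<Longrightarrow> k \<in> int_box (n k)" using int_box_exhaust by metis
  define m where "m = Suc (Max (insert 0 (n ` F)))"
  have cover: "\<exists>j\<in>{..<m}. k \<in> dyadic_block j" if kF: "k \<in> F" for k
  proof -
    obtain j where "j \<le> n k" "k \<in> dyadic_block j" using int_box_cover[OF n[OF kF]] by blast
    moreover have "n k < m" unfolding m_def less_Suc_eq_le using F kF by (intro Max_ge) auto
    ultimately show ?thesis by auto
  qed
  have "(\<Sum>k\<in>F. norm (a k)) \<le> (\<Sum>j<m. \<Sum>k\<in>{k \<in> F. k \<in> dyadic_block j}. norm (a k))"
    using F cover by (intro sum_le_sum_cover) auto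
  also have "\<dots> \<le> (\<Sum>j<m. if j \<le> J then 0 else p ^ j)"
  proof (rule sum_mono)
    fix j
    show "(\<Sum>k\<in>{k \<in> F. k \<in> dyadic_block j}. norm (a k)) \<le> (if j \<le> J then 0 else p ^ j)"
    proof (cases "j \<le> J")
      case True
      then have "{k \<in> F. k \<in> dyadic_block j} = {}"
        using F(2) dyadic_block_subset_int_box int_box_mono[OF True] by blast
      then show ?thesis using True by (simp only: sum.empty if_True order_refl)
    next
      case False
      have "(\<Sum>k\<in>{k \<in> F. k \<in> dyadic_block j}. norm (a k)) \<le> (\<Sum>k\<in>dyadic_block j. norm (a k))"
        by (intro sum_mono2 finite_dyadic_block) auto
      then show ?thesis using block_l1_le[of j] False by (simp add: p_def)
    qed
  qed
  also have "\<dots> \<le> p ^ (J + 1) / (1 - p)" using p by (rule geometric_tail_le)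
  also have "\<dots> \<le> p ^ J / (1 - p)" using p by (intro divide_right_mono) (auto simp: mult_left_le_one_le)
  finally show ?thesis by (simp add: p_def)
qed

lemma l1_le:
  assumes F: "finite F"
  shows "(\<Sum>k\<in>F. norm (a k)) \<le> 1 + 1 / (1 - 2 powr (- r))"
proof -
  have "(\<Sum>k\<in>F. norm (a k)) = (\<Sum>k\<in>F \<inter> int_box 0. norm (a k)) + (\<Sum>k\<in>F - int_box 0. norm (a k))"
    using F by (subst sum.Int_Diff[of F _ "int_box 0"]) auto
  also have "(\<Sum>k\<in>F \<inter> int_box 0. norm (a k)) \<le> (\<Sum>k\<in>dyadic_block 0. norm (a k))"
    using int_box_cover[of _ 0] by (intro sum_mono2 finite_dyadic_block) auto
  also have "\<dots> \<le> 1" using block_l1_le[of 0] by simp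
  also have "(\<Sum>k\<in>F - int_box 0. norm (a k)) \<le> 1 / (1 - 2 powr (- r))"
    using tail_l1_le[of "F - int_box 0" 0] F by auto
  finally show ?thesis by simp
qed

text \<open>Blocks up to \<open>n\<close> are charged by their full cardinality, at most v/4
  together. Later blocks are charged by the \<beta>-condition, and \<epsilon> solves
  \<epsilon>^(-\<beta>) q^(n+1) / (1-q) = v/4, so they cost at most v/4 too, whatever
  \<open>J\<close> is. For the largest such n one has 2^n of order v^(1/d), hence \<epsilon> of
  order v^(-1/\<beta> - r/d): the smoothness gain r/d arises here.\<close>

lemma large_coefficients:
  fixes v n :: nat
  defines "q \<equiv> 2 powr (- r * \<beta>)"
  assumes n: "4 * (2::real) ^ ((n + 2) * CARD('d)) \<le> real v"
  defines "\<epsilon> \<equiv> (real v * (1 - q) / 4) powr (- 1 / \<beta>) * 2 powr (- r * real (n + 1))"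
  shows "\<exists>S\<subseteq>int_box J. real (card S) \<le> real v / 2 \<and> (\<Sum>k\<in>int_box J - S. norm (a k)) \<le> \<epsilon> * (real v / 2)"
proof -
  define D where "D = (2::real) ^ CARD('d)"
  have D2: "2 \<le> D" unfolding D_def using power_increasing[of 1 "CARD('d)" "2::real"] by simp
  have q: "0 < q" "q < 1" using r \<beta> by (auto simp: q_def powr_less_one)
  have v0: "0 < real v" using n by (smt (verit) zero_less_power)
  have \<epsilon>0: "0 < \<epsilon>" unfolding \<epsilon>_def using v0 q by simp
  have \<epsilon>q: "\<epsilon> powr (- \<beta>) * (q ^ (n + 1) / (1 - q)) = real v / 4"
  proof -
    have "\<epsilon> powr (- \<beta>) = ((real v * (1 - q) / 4) powr (- 1 / \<beta>)) powr (- \<beta>) * (2 powr (- r * real (n + 1))) powr (- \<beta>)"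
      unfolding \<epsilon>_def by (rule powr_mult)
    also have "((real v * (1 - q) / 4) powr (- 1 / \<beta>)) powr (- \<beta>) = real v * (1 - q) / 4"
      using \<beta> v0 q by (simp add: powr_powr)
    also have "(2 powr (- r * real (n + 1))) powr (- \<beta>) = 2 powr (- ((- r * \<beta>) * real (n + 1)))"
      by (simp add: powr_powr mult_ac)
    also have "\<dots> = 1 / q ^ (n + 1)"
      unfolding powr_minus powr_base_power[OF zero_less_numeral] q_def by (simp add: inverse_eq_divide)
    finally show ?thesis using q by (simp add: field_simps)
  qed
  \<comment> \<open>A common majorant: x j bounds the number of large coefficients in block j, and
    \<epsilon> * x j the sum of its small ones.\<close>
  define x where "x j = (if j \<le> n then D ^ (j + 1) else \<epsilon> powr (- \<beta>) * q ^ j)" for j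
  have X: "(\<Sum>j<Suc J. x j) \<le> real v / 2"
  proof -
    have geo: "(\<Sum>j<m. D ^ (j + 1)) \<le> D ^ (m + 1)" for m
    proof (induction m)
      case (Suc m)
      then have "(\<Sum>j<Suc m. D ^ (j + 1)) \<le> 2 * D ^ (m + 1)" by simp
      also have "\<dots> \<le> D * D ^ (m + 1)" using D2 by (intro mult_right_mono) auto
      finally show ?case by simp
    qed (use D2 in simp)
    have "(\<Sum>j<Suc J. x j) = (\<Sum>j<Suc J. if j \<le> n then D ^ (j + 1) else 0) + (\<Sum>j<Suc J. \<epsilon> powr (- \<beta>) * (if j \<le> n then 0 else q ^ j))"
      unfolding sum.distrib[symmetric] x_def by (intro sum.cong) auto
    also have "(\<Sum>j<Suc J. if j \<le> n then D ^ (j + 1) else 0) = (\<Sum>j\<in>{j. j < Suc J \<and> j \<le> n}. D ^ (j + 1))"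
      by (subst sum.inter_filter[symmetric]) auto
    also have "\<dots> \<le> (\<Sum>j<n + 1. D ^ (j + 1))" using D2 by (intro sum_mono2) auto
    also have "\<dots> \<le> D ^ (n + 2)" using geo[of "n + 1"] by simp
    also have "D ^ (n + 2) \<le> real v / 4" using n unfolding D_def power_mult[symmetric] by (simp add: mult.commute)
    also have "(\<Sum>j<Suc J. \<epsilon> powr (- \<beta>) * (if j \<le> n then 0 else q ^ j)) \<le> \<epsilon> powr (- \<beta>) * (q ^ (n + 1) / (1 - q))"
      unfolding sum_distrib_left[symmetric] by (intro mult_left_mono geometric_tail_le q) auto
    finally show ?thesis unfolding \<epsilon>q by simp
  qed
  have cardB: "real (card (dyadic_block j :: (int ^ 'd) set)) \<le> D ^ (j + 1)" for j
  proof -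
    have "card (dyadic_block j :: (int ^ 'd) set) \<le> card (int_box j :: (int ^ 'd) set)"
      by (intro card_mono finite_int_box dyadic_block_subset_int_box)
    also have "\<dots> \<le> 2 ^ ((j + 1) * CARD('d))" by (rule card_int_box)
    finally have "real (card (dyadic_block j :: (int ^ 'd) set)) \<le> real (2 ^ ((j + 1) * CARD('d)))"
      by (rule of_nat_mono)
    also have "\<dots> = D ^ (j + 1)" unfolding D_def power_mult[symmetric] by (simp add: mult.commute)
    finally show ?thesis .
  qed
  have cover: "\<exists>j\<in>{..<Suc J}. k \<in> dyadic_block j" if "k \<in> int_box J" for k
    using int_box_cover[OF that] by (auto simp: less_Suc_eq_le)
  define S where "S = {k \<in> int_box J. \<epsilon> < norm (a k)}"
  have finS: "finite S" unfolding S_def by (rule finite_subset[OF _ finite_int_box[of J]]) auto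
  have "real (card S) = (\<Sum>k\<in>S. 1)" by simp
  also have "\<dots> \<le> (\<Sum>j<Suc J. \<Sum>k\<in>{k \<in> S. k \<in> dyadic_block j}. 1)"
    using finS cover by (intro sum_le_sum_cover) (auto simp: S_def)
  also have "\<dots> \<le> (\<Sum>j<Suc J. x j)"
  proof (rule sum_mono)
    fix j
    have "real (card {k \<in> S. k \<in> dyadic_block j}) \<le> real (card {k \<in> dyadic_block j. \<epsilon> < norm (a k)})"
      by (intro of_nat_mono card_mono) (auto simp: S_def finite_dyadic_block)
    moreover have "real (card {k \<in> dyadic_block j. \<epsilon> < norm (a k)}) \<le> real (card (dyadic_block j :: (int ^ 'd) set))"
      by (intro of_nat_mono card_mono) (auto simp: finite_dyadic_block)
    ultimately show "(\<Sum>k\<in>{k \<in> S. k \<in> dyadic_block j}. 1) \<le> x j"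
      using block_large_card_le[OF \<epsilon>0, of j] cardB[of j] by (auto simp: x_def q_def)
  qed
  finally have c1: "real (card S) \<le> real v / 2" using X by simp
  have "(\<Sum>k\<in>int_box J - S. norm (a k)) \<le> (\<Sum>j<Suc J. \<Sum>k\<in>{k \<in> int_box J - S. k \<in> dyadic_block j}. norm (a k))"
    using cover by (intro sum_le_sum_cover) (auto simp: finite_int_box)
  also have "\<dots> \<le> (\<Sum>j<Suc J. \<epsilon> * x j)"
  proof (rule sum_mono)
    fix j
    let ?B = "{k \<in> dyadic_block j. norm (a k) \<le> \<epsilon>}"
    have finB: "finite ?B" by (simp add: finite_dyadic_block)
    have "(\<Sum>k\<in>{k \<in> int_box J - S. k \<in> dyadic_block j}. norm (a k)) \<le> (\<Sum>k\<in>?B. norm (a k))"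
      using finB by (intro sum_mono2) (auto simp: S_def)
    moreover have "(\<Sum>k\<in>?B. norm (a k)) \<le> \<epsilon> * D ^ (j + 1)"
    proof -
      have "(\<Sum>k\<in>?B. norm (a k)) \<le> (\<Sum>k\<in>?B. \<epsilon>)" by (intro sum_mono) auto
      also have "\<dots> = \<epsilon> * real (card ?B)" by simp
      also have "\<dots> \<le> \<epsilon> * real (card (dyadic_block j :: (int ^ 'd) set))"
        using \<epsilon>0 by (intro mult_left_mono of_nat_mono card_mono) (auto simp: finite_dyadic_block)
      also have "\<dots> \<le> \<epsilon> * D ^ (j + 1)" using \<epsilon>0 by (intro mult_left_mono cardB) auto
      finally show ?thesis .
    qed
    ultimately show "(\<Sum>k\<in>{k \<in> int_box J - S. k \<in> dyadic_block j}. norm (a k)) \<le> \<epsilon> * x j"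
      using block_small_sum_le[OF \<epsilon>0, of j] by (auto simp: x_def q_def)
  qed
  also have "\<dots> \<le> \<epsilon> * (real v / 2)"
    unfolding sum_distrib_left[symmetric] using \<epsilon>0 X by (intro mult_left_mono) auto
  finally have "(\<Sum>k\<in>int_box J - S. norm (a k)) \<le> \<epsilon> * (real v / 2)" .
  then show ?thesis using c1 by (intro exI[of _ S]) (auto simp: S_def)
qed

end

section \<open>Recovery from samples\<close>

lemma add_powr_le:
  fixes a b p :: real
  assumes "0 \<le> a" "0 \<le> b" "0 \<le> p"
  shows "(a + b) powr p \<le> 2 powr p * (a powr p + b powr p)"
proof -
  have "(a + b) powr p \<le> (2 * max a b) powr p" using assms by (intro powr_mono2) auto
  also have "\<dots> = 2 powr p * max a b powr p" by (rule powr_mult)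
  also have "\<dots> \<le> 2 powr p * (a powr p + b powr p)"
    by (intro mult_left_mono) (auto simp: max_def)
  finally show ?thesis .
qed

text \<open>Using a majorant \<open>G\<close> avoids any measurability question about the infinite
  series f: if its p-th power is not integrable, the Bochner integral is 0 by convention and the
  bound still holds.\<close>

lemma Lp_norm_le:
  assumes p: "0 < p" and G: "integrable M G" "\<And>x. x \<in> space M \<Longrightarrow> norm (f x) powr p \<le> G x"
    and b: "0 \<le> b" "(\<integral>x. G x \<partial>M) \<le> b powr p"
  shows "Lp_norm M p f \<le> b"
proof -
  have "(\<integral>x. norm (f x) powr p \<partial>M) \<le> (\<integral>x. G x \<partial>M)"
  proof (cases "integrable M (\<lambda>x. norm (f x) powr p)")
    case True
    then show ?thesis using G by (intro integral_mono) auto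
  next
    case False
    have "0 \<le> G x" if "x \<in> space M" for x using G(2)[OF that] by (rule order_trans[rotated]) simp
    then have "0 \<le> (\<integral>x. G x \<partial>M)" by (rule Bochner_Integration.integral_nonneg)
    then show ?thesis using False by (simp add: not_integrable_integral_eq)
  qed
  then have "Lp_norm M p f \<le> (b powr p) powr (1 / p)"
    unfolding Lp_norm_def using b p
    by (intro powr_mono2 Bochner_Integration.integral_nonneg) auto
  also have "\<dots> = b" using b p by (simp add: powr_powr)
  finally show ?thesis .
qed

lemma Lp_norm_powr: "0 < p \<Longrightarrow> Lp_norm M p f powr p = (\<integral>x. norm (f x) powr p \<partial>M)"
  unfolding Lp_norm_def by (simp add: powr_powr Bochner_Integration.integral_nonneg)

context prob_space
begin

lemma integrable_norm_powr_bounded: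
  fixes g :: "'a \<Rightarrow> complex"
  assumes "g \<in> borel_measurable M" "\<And>x. x \<in> space M \<Longrightarrow> norm (g x) \<le> c" "0 \<le> p"
  shows "integrable M (\<lambda>x. norm (g x) powr p)"
proof (rule integrable_const_bound)
  show "AE x in M. norm (norm (g x) powr p) \<le> c powr p"
    using assms by (intro AE_I2) (auto intro: powr_mono2)
  show "(\<lambda>x. norm (g x) powr p) \<in> borel_measurable M" using assms(1) by measurable
qed

text \<open>Jensen's inequality would give the constant 1 instead of 2.\<close>

lemma Lp_norm_ge_L2_norm:
  fixes g :: "'a \<Rightarrow> complex"
  assumes g: "g \<in> borel_measurable M" "\<And>x. x \<in> space M \<Longrightarrow> norm (g x) \<le> c" and p: "2 \<le> p"
  shows "Lp_norm M 2 g \<le> 2 * Lp_norm M p g"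
proof (cases "(\<integral>x. norm (g x) powr 2 \<partial>M) = 0")
  case True
  then show ?thesis by (simp add: Lp_norm_def)
next
  case False
  define s where "s = (\<integral>x. norm (g x) powr 2 \<partial>M)"
  have s: "0 < s" using False unfolding s_def by (metis Bochner_Integration.integral_nonneg less_eq_real_def powr_ge_zero)
  have i2: "integrable M (\<lambda>x. norm (g x) powr 2)" and ip: "integrable M (\<lambda>x. norm (g x) powr p)"
    by (rule integrable_norm_powr_bounded[OF g]; use p in simp)+
  \<comment> \<open>Points where the square of |g| is below half its mean account for at most half
    of the second moment. Above that value the square is dominated by a multiple of the p-th
    power.\<close>
  define e where "e = s / 2"
  have e: "0 < e" using s by (simp add: e_def)
  have pt: "y powr 2 \<le> e + e powr (1 - p / 2) * y powr p" if y: "0 \<le> y" for y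
  proof (cases "y powr 2 \<le> e")
    case True
    then show ?thesis by (simp add: add_increasing2)
  next
    case False
    then have y0: "0 < y" using y e by (cases "y = 0") auto
    have "(y powr 2) powr (1 - p / 2) \<le> e powr (1 - p / 2)"
      using False e p by (intro powr_mono2') auto
    then have "(y powr 2) powr (1 - p / 2) * y powr p \<le> e powr (1 - p / 2) * y powr p"
      by (intro mult_right_mono) auto
    moreover have "(y powr 2) powr (1 - p / 2) * y powr p = y powr 2"
      unfolding powr_powr powr_add[symmetric] by (simp add: field_simps)
    ultimately show ?thesis using e by simp
  qed
  have "s \<le> (\<integral>x. e + e powr (1 - p / 2) * norm (g x) powr p \<partial>M)"
    unfolding s_def using i2 ip pt by (intro integral_mono) auto
  also have "\<dots> = e + e powr (1 - p / 2) * (\<integral>x. norm (g x) powr p \<partial>M)"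
    using ip by (simp add: prob_space)
  finally have "e \<le> e powr (1 - p / 2) * (\<integral>x. norm (g x) powr p \<partial>M)" by (simp add: e_def)
  then have "e * e powr (p / 2 - 1) \<le> (e powr (1 - p / 2) * (\<integral>x. norm (g x) powr p \<partial>M)) * e powr (p / 2 - 1)"
    by (intro mult_right_mono) auto
  also have "\<dots> = (e powr (1 - p / 2) * e powr (p / 2 - 1)) * (\<integral>x. norm (g x) powr p \<partial>M)" by (simp only: mult_ac)
  also have "e powr (1 - p / 2) * e powr (p / 2 - 1) = 1" unfolding powr_add[symmetric] using e by simp
  also have "e * e powr (p / 2 - 1) = e powr (p / 2)" using e by (simp add: powr_diff)
  finally have "(e powr (p / 2)) powr (1 / p) \<le> Lp_norm M p g"
    unfolding Lp_norm_def using p by (intro powr_mono2) auto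
  then have "e powr (1 / 2) \<le> Lp_norm M p g" using p by (simp add: powr_powr)
  moreover have "Lp_norm M 2 g = sqrt s" using s by (simp add: Lp_norm_def s_def powr_half_sqrt)
  moreover have "sqrt s \<le> 2 * e powr (1 / 2)"
  proof (rule real_sqrt_le_iff[THEN iffD2, of s "4 * e", THEN order_trans])
    show "sqrt (4 * e) \<le> 2 * e powr (1 / 2)" using e by (simp add: powr_half_sqrt real_sqrt_mult)
  qed (use s in \<open>simp add: e_def\<close>)
  ultimately show ?thesis by linarith
qed

end

text \<open>Coefficients over \<open>S\<close> are kept exactly and only the rest is averaged, with
  v div 2 draws. Closeness in L_p and closeness on the sample come from one gauge, integrated
  against M with power p and against the empirical measure with power 2; hence \<open>eq\<close> and
  \<open>pt\<close> admit all q between 2 and p.\<close>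

lemma sparse_candidate_exists:
  fixes \<psi> :: "'i \<Rightarrow> 'a \<Rightarrow> complex" and \<xi> :: "nat \<Rightarrow> 'a"
  assumes M: "prob_space M" and Q: "finite Q" "Q \<noteq> {}"
    and \<psi>: "\<And>k x. k \<in> Q \<Longrightarrow> x \<in> space M \<Longrightarrow> norm (\<psi> k x) \<le> 1"
    and meas: "\<And>k. k \<in> Q \<Longrightarrow> \<psi> k \<in> borel_measurable M"
    and p: "2 \<le> p" and v: "2 \<le> v"
    and S: "S \<subseteq> Q" "real (card S) \<le> real v / 2"
    and A: "0 < A" "2 * (\<Sum>k\<in>Q - S. norm (a k)) \<le> A"
    and \<xi>: "\<And>j. j < m \<Longrightarrow> \<xi> j \<in> space M" and m: "0 < m"
    and tail: "\<And>x. x \<in> space M \<Longrightarrow> norm (f x - (\<Sum>k\<in>Q. a k * \<psi> k x)) \<le> t" and t: "0 \<le> t"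
    and W: "7 * p * A / sqrt (real v) + t \<le> W"
  shows "\<exists>S' b G. S' \<subseteq> Q \<and> card S' \<le> v \<and> integrable M G \<and>
    (\<forall>x\<in>space M. norm (f x - (\<Sum>k\<in>S'. b k * \<psi> k x)) powr p \<le> G x) \<and>
    (\<integral>x. G x \<partial>M) \<le> (10 * W) powr p \<and>
    (\<Sum>j<m. (norm (f (\<xi> j) - (\<Sum>k\<in>S'. b k * \<psi> k (\<xi> j))))\<^sup>2) / real m \<le> (10 * W)\<^sup>2"
proof -
  interpret prob_space M by (rule M)
  define s where "s = v div 2"
  have s: "0 < s" using v by (simp add: s_def)
  \<comment> \<open>The worst case is v = 3 with s = 1. Below, 7/4 >= sqrt 3 turns the factor 4 of
    \<open>B\<close> into the 7 of the hypothesis on \<open>W\<close>.\<close>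
  have sv: "real v \<le> 3 * real s"
  proof -
    have "v \<le> 3 * s" unfolding s_def using v by presburger
    then show ?thesis by linarith
  qed
  \<comment> \<open>Now 4 l^2 s = 1, so the gauge has mean at most 8 e <= 24 and the q-th moment
    gives an error of order q A / sqrt s, with no exceptional set and no logarithm.\<close>
  define l where "l = 1 / (2 * sqrt (real s))"
  have l: "0 < l" "\<bar>l\<bar> \<le> 1/2" using s by (auto simp: l_def field_simps)
  have ls: "4 * l\<^sup>2 * real s = 1" using s by (simp add: l_def power_divide power_mult_distrib)
  define b0 where "b0 k = (if k \<in> S then 0 else a k)" for k
  have b0: "(\<Sum>k\<in>Q. \<bar>Re (b0 k)\<bar> + \<bar>Im (b0 k)\<bar>) \<le> A"
  proof -
    have "(\<Sum>k\<in>Q. \<bar>Re (b0 k)\<bar> + \<bar>Im (b0 k)\<bar>) \<le> 2 * (\<Sum>k\<in>Q. norm (b0 k))" by (rule sum_abs_Re_Im_le)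
    also have "(\<Sum>k\<in>Q. norm (b0 k)) = (\<Sum>k\<in>Q - S. norm (a k))"
      unfolding b0_def using Q by (intro sum.mono_neutral_cong_right) auto
    finally show ?thesis using A by simp
  qed
  obtain g where g: "g \<in> PiE {..<s} (\<lambda>_. Q \<times> phases)"
    and int: "integrable M (\<lambda>x. exp_gauge l (of_real (real s / A) * (dict_average \<psi> A s g x - (\<Sum>k\<in>Q. b0 k * \<psi> k x))))" (is "integrable M ?h")
    and le1: "(\<integral>x. exp_gauge l (of_real (real s / A) * (dict_average \<psi> A s g x - (\<Sum>k\<in>Q. b0 k * \<psi> k x))) \<partial>M) \<le> 8 * exp (4 * l\<^sup>2 * real s)"
    and le2: "(\<Sum>j<m. exp_gauge l (of_real (real s / A) * (dict_average \<psi> A s g (\<xi> j) - (\<Sum>k\<in>Q. b0 k * \<psi> k (\<xi> j))))) / real m \<le> 8 * exp (4 * l\<^sup>2 * real s)"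
    by (rule sparse_approximation_exists[OF M Q _ _ A(1) b0 l(2) _ m s, where \<psi>=\<psi> and \<xi>=\<xi>]) (use \<psi> meas \<xi> in auto)
  have e24: "8 * exp (4 * l\<^sup>2 * real s) \<le> 24" unfolding ls using exp_le by simp
  have "fst (g i) \<in> Q" if "i < s" for i using PiE_mem[OF g, of i] that by (auto simp: mem_Times_iff)
  then obtain S1 b1 where S1: "S1 \<subseteq> Q" "finite S1" "card S1 \<le> s"
    and b1: "\<And>x. dict_average \<psi> A s g x = (\<Sum>k\<in>S1. b1 k * \<psi> k x)"
    using dict_average_eq_sum[of s g Q \<psi> A] by blast
  define S' where "S' = S \<union> S1"
  define b where "b k = (if k \<in> S then a k else 0) + (if k \<in> S1 then b1 k else 0)" for k
  have finS: "finite S" using S Q finite_subset by blast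
  have S': "S' \<subseteq> Q" "card S' \<le> v"
  proof -
    show "S' \<subseteq> Q" using S S1 by (simp add: S'_def)
    have "card S \<le> s" using S(2) unfolding s_def by linarith
    then show "card S' \<le> v" unfolding S'_def using card_Un_le[of S S1] S1(3) by (simp add: s_def)
  qed
  define e where "e x = dict_average \<psi> A s g x - (\<Sum>k\<in>Q. b0 k * \<psi> k x)" for x
  have fe: "f x - (\<Sum>k\<in>S'. b k * \<psi> k x) = (f x - (\<Sum>k\<in>Q. a k * \<psi> k x)) - e x" for x
  proof -
    have "(\<Sum>k\<in>S'. b k * \<psi> k x) = (\<Sum>k\<in>S'. (if k \<in> S then a k else 0) * \<psi> k x) + (\<Sum>k\<in>S'. (if k \<in> S1 then b1 k else 0) * \<psi> k x)"
      unfolding b_def by (simp add: sum.distrib distrib_right)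
    also have "(\<Sum>k\<in>S'. (if k \<in> S1 then b1 k else 0) * \<psi> k x) = (\<Sum>k\<in>S1. b1 k * \<psi> k x)"
      unfolding S'_def using finS S1 by (intro sum.mono_neutral_cong_right) auto
    also have "(\<Sum>k\<in>S'. (if k \<in> S then a k else 0) * \<psi> k x) = (\<Sum>k\<in>Q. (if k \<in> S then a k else 0) * \<psi> k x)"
      using S'(1) Q by (intro sum.mono_neutral_left) (auto simp: S'_def)
    also have "\<dots> = (\<Sum>k\<in>Q. a k * \<psi> k x) - (\<Sum>k\<in>Q. b0 k * \<psi> k x)"
      unfolding sum_subtractf[symmetric] b0_def by (intro sum.cong) auto
    finally show ?thesis by (simp add: e_def b1)
  qed
  define B where "B = 4 * p * A / sqrt (real s)"
  have B0: "0 < B" using p A s by (simp add: B_def)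
  have eq: "norm (e x) powr q \<le> B powr q * ?h x" if q: "2 \<le> q" "q \<le> p" for q x
  proof -
    have "norm (of_real (real s / A) * e x) powr q \<le> (2 * q / l) powr q * ?h x"
      unfolding e_def using l q by (intro norm_powr_le_exp_gauge) auto
    then have "(A / real s) powr q * norm (of_real (real s / A) * e x) powr q \<le> (A / real s) powr q * ((2 * q / l) powr q * ?h x)"
      by (intro mult_left_mono) auto
    also have "(A / real s) powr q * norm (of_real (real s / A) * e x) powr q = norm (e x) powr q"
      unfolding powr_mult[symmetric] norm_mult norm_of_real using A s by simp
    also have "(A / real s) powr q * ((2 * q / l) powr q * ?h x) = (A / real s * (2 * q / l)) powr q * ?h x"
      by (simp only: powr_mult mult.assoc)
    also have "A / real s * (2 * q / l) = 4 * q * A / sqrt (real s)"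
      using s unfolding l_def by (simp add: field_simps power2_eq_square[symmetric])
    also have "(4 * q * A / sqrt (real s)) powr q * ?h x \<le> B powr q * ?h x"
      unfolding B_def using q A s
      by (intro mult_right_mono powr_mono2 divide_right_mono exp_gauge_nonneg) (auto intro!: mult_right_mono)
    finally show ?thesis .
  qed
  have BW: "B + t \<le> W"
  proof -
    have "sqrt (real v) \<le> sqrt ((7/4)\<^sup>2 * real s)" using sv s by (intro real_sqrt_le_mono) (simp add: power2_eq_square)
    then have "sqrt (real v) \<le> 7/4 * sqrt (real s)" by (simp add: real_sqrt_mult)
    then have "4 * p * A * sqrt (real v) \<le> 4 * p * A * (7/4 * sqrt (real s))"
      using p A by (intro mult_left_mono) auto
    then have "B \<le> 7 * p * A / sqrt (real v)"
      unfolding B_def using s v by (simp add: field_simps)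
    then show ?thesis using W by linarith
  qed
  have Bt: "B \<le> W" "t \<le> W" "0 < W" using BW B0 t by auto
  have pt: "norm (f x - (\<Sum>k\<in>S'. b k * \<psi> k x)) powr q \<le> 2 powr q * (t powr q + B powr q * ?h x)"
    if x: "x \<in> space M" and q: "2 \<le> q" "q \<le> p" for x q
  proof -
    have "norm (f x - (\<Sum>k\<in>S'. b k * \<psi> k x)) \<le> t + norm (e x)"
      unfolding fe by (rule order_trans[OF norm_triangle_ineq4]) (use tail[OF x] in simp)
    then have "norm (f x - (\<Sum>k\<in>S'. b k * \<psi> k x)) powr q \<le> (t + norm (e x)) powr q"
      using q by (intro powr_mono2) auto
    also have "\<dots> \<le> 2 powr q * (t powr q + norm (e x) powr q)" using t q by (intro add_powr_le) auto
    also have "\<dots> \<le> 2 powr q * (t powr q + B powr q * ?h x)"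
      using eq[OF q] by (intro mult_left_mono add_left_mono) auto
    finally show ?thesis .
  qed
  \<comment> \<open>At most 1 + 24 = 25 copies of W powr q occur, and 25 <= 5 powr q since q >= 2.
    With the 2 powr q of the triangle inequality this yields 10.\<close>
  have bound: "2 powr q * (t powr q + B powr q * z) \<le> (10 * W) powr q" if q: "2 \<le> q" and z: "z \<le> 24" for q z
  proof -
    have "t powr q + B powr q * z \<le> W powr q + W powr q * 24"
    proof (rule add_mono)
      show "t powr q \<le> W powr q" using Bt t q by (intro powr_mono2) auto
      have "B powr q * z \<le> B powr q * 24" using z by (intro mult_left_mono) auto
      also have "\<dots> \<le> W powr q * 24" using Bt B0 q by (intro mult_right_mono powr_mono2) auto
      finally show "B powr q * z \<le> W powr q * 24" .
    qed
    also have "\<dots> = 25 * W powr q" by simp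
    also have "\<dots> \<le> 5 powr q * W powr q"
      using powr_mono[of 2 q "5::real"] q by (intro mult_right_mono) auto
    finally have "2 powr q * (t powr q + B powr q * z) \<le> 2 powr q * (5 powr q * W powr q)"
      by (intro mult_left_mono) auto
    also have "\<dots> = (10 * W) powr q" by (simp add: powr_mult[symmetric])
    finally show ?thesis .
  qed
  let ?G = "\<lambda>x. 2 powr p * (t powr p + B powr p * ?h x)"
  have "integrable M ?G" using int by simp
  moreover have "(\<integral>x. ?G x \<partial>M) \<le> (10 * W) powr p"
  proof -
    have "(\<integral>x. ?G x \<partial>M) = 2 powr p * (t powr p + B powr p * (\<integral>x. ?h x \<partial>M))"
      using int by (simp add: prob_space)
    then show ?thesis using bound[OF p, of "\<integral>x. ?h x \<partial>M"] le1 e24 by simp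
  qed
  moreover have "(\<Sum>j<m. (norm (f (\<xi> j) - (\<Sum>k\<in>S'. b k * \<psi> k (\<xi> j))))\<^sup>2) / real m \<le> (10 * W)\<^sup>2"
  proof -
    have sq: "y powr 2 = y\<^sup>2" if "0 \<le> y" for y :: real using that by (cases "y = 0") simp_all
    have "(\<Sum>j<m. (norm (f (\<xi> j) - (\<Sum>k\<in>S'. b k * \<psi> k (\<xi> j))))\<^sup>2) / real m
       \<le> (\<Sum>j<m. 2 powr 2 * (t powr 2 + B powr 2 * ?h (\<xi> j))) / real m"
    proof (intro divide_right_mono sum_mono)
      fix j assume "j \<in> {..<m}"
      then have "norm (f (\<xi> j) - (\<Sum>k\<in>S'. b k * \<psi> k (\<xi> j))) powr 2 \<le> 2 powr 2 * (t powr 2 + B powr 2 * ?h (\<xi> j))"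
        using p by (intro pt \<xi>) auto
      then show "(norm (f (\<xi> j) - (\<Sum>k\<in>S'. b k * \<psi> k (\<xi> j))))\<^sup>2 \<le> 2 powr 2 * (t powr 2 + B powr 2 * ?h (\<xi> j))"
        by (simp only: sq[OF norm_ge_zero])
    qed simp
    also have "\<dots> = 2 powr 2 * (t powr 2 + B powr 2 * ((\<Sum>j<m. ?h (\<xi> j)) / real m))"
      unfolding sum_distrib_left[symmetric] sum.distrib using m by (simp add: field_simps)
    also have "\<dots> \<le> (10 * W) powr 2"
      using le2 e24 by (intro bound) auto
    finally show ?thesis using Bt(3) by (simp add: sq)
  qed
  ultimately show ?thesis
    using S' pt[OF _ p order_refl] by (intro exI[of _ S'] exI[of _ b] exI[of _ ?G]) auto
qed

text \<open>The recovery map only has to return some sparse polynomial whose misfit is within the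
  prescribed bound; the unknown candidate shows that one exists. The difference of the two is
  2v-sparse and small on the sample, hence small in L_2 and then in L_p.\<close>

lemma optimal_recovery_le_sparse:
  fixes \<psi> :: "'i \<Rightarrow> 'a \<Rightarrow> complex" and \<xi> :: "nat \<Rightarrow> 'a"
  assumes M: "prob_space M" and Q: "finite Q"
    and \<psi>: "\<And>k x. k \<in> Q \<Longrightarrow> x \<in> space M \<Longrightarrow> norm (\<psi> k x) \<le> 1"
    and meas: "\<And>k. k \<in> Q \<Longrightarrow> \<psi> k \<in> borel_measurable M"
    and p: "2 \<le> p" and H: "1/2 \<le> H" and W: "0 \<le> W"
    and \<xi>: "\<And>j. j < m \<Longrightarrow> \<xi> j \<in> space M"
    and discr: "\<And>S b. S \<subseteq> Q \<Longrightarrow> card S \<le> 2 * v \<Longrightarrow>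
      (\<integral>x. (norm (\<Sum>k\<in>S. b k * \<psi> k x))\<^sup>2 \<partial>M) \<le> 400 * ((\<Sum>j<m. (norm (\<Sum>k\<in>S. b k * \<psi> k (\<xi> j)))\<^sup>2) / real m)"
    and nikolskii: "\<And>S b. S \<subseteq> Q \<Longrightarrow> card S \<le> 2 * v \<Longrightarrow>
      Lp_norm M p (\<lambda>x. \<Sum>k\<in>S. b k * \<psi> k x) \<le> H * Lp_norm M 2 (\<lambda>x. \<Sum>k\<in>S. b k * \<psi> k x)"
    and candidate: "\<And>f. f \<in> F \<Longrightarrow> \<exists>S b G. S \<subseteq> Q \<and> card S \<le> v \<and> integrable M G \<and>
      (\<forall>x\<in>space M. norm (f x - (\<Sum>k\<in>S. b k * \<psi> k x)) powr p \<le> G x) \<and>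
      (\<integral>x. G x \<partial>M) \<le> (10 * W) powr p \<and>
      (\<Sum>j<m. (norm (f (\<xi> j) - (\<Sum>k\<in>S. b k * \<psi> k (\<xi> j))))\<^sup>2) / real m \<le> (10 * W)\<^sup>2"
  shows "optimal_recovery (space M) M p m F \<le> ereal (1600 * H * W)"
proof -
  interpret prob_space M by (rule M)
  define good where "good y S b \<longleftrightarrow> S \<subseteq> Q \<and> card S \<le> v \<and>
      (\<Sum>j<m. (norm (y ! j - (\<Sum>k\<in>S. b k * \<psi> k (\<xi> j))))\<^sup>2) / real m \<le> (10 * W)\<^sup>2" for y S b
  \<comment> \<open>The implication keeps the choice total: data without a good fit still receive a
    sparse polynomial, so the map takes values in L_p everywhere, as admissible maps must.\<close>
  have "\<exists>S b. S \<subseteq> Q \<and> card S \<le> v \<and> ((\<exists>S b. good y S b) \<longrightarrow> good y S b)" for y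
  proof (cases "\<exists>S b. good y S b")
    case True
    then show ?thesis unfolding good_def by blast
  next
    case False
    then show ?thesis by (intro exI[of _ "{}"]) auto
  qed
  then obtain S\<^sub>M b\<^sub>M where SM: "\<And>y. S\<^sub>M y \<subseteq> Q \<and> card (S\<^sub>M y) \<le> v"
    and best: "\<And>y S b. good y S b \<Longrightarrow> good y (S\<^sub>M y) (b\<^sub>M y)" by metis
  define R where "R y x = (\<Sum>k\<in>S\<^sub>M y. b\<^sub>M y k * \<psi> k x)" for y x
  have comb_meas: "(\<lambda>x. \<Sum>k\<in>S. b k * \<psi> k x) \<in> borel_measurable M" if "S \<subseteq> Q" for S b
    using that meas by (intro borel_measurable_sum borel_measurable_times) auto
  have comb_int: "integrable M (\<lambda>x. norm (\<Sum>k\<in>S. b k * \<psi> k x) powr p)" if S: "S \<subseteq> Q" for S b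
  proof (rule integrable_norm_powr_bounded[OF comb_meas[OF S]])
    fix x assume "x \<in> space M"
    then show "norm (\<Sum>k\<in>S. b k * \<psi> k x) \<le> (\<Sum>k\<in>S. norm (b k))"
      using S \<psi> by (intro order_trans[OF norm_sum] sum_mono) (auto simp: norm_mult intro!: mult_left_le)
  qed (use p in simp)
  have R_Lp: "in_Lp M p (R y)" for y
    unfolding in_Lp_def R_def[abs_def] using comb_meas comb_int SM by blast
  have err: "Lp_norm M p (\<lambda>x. f x - R (map f (map \<xi> [0..<m])) x) \<le> 1600 * H * W" if f: "f \<in> F" for f
  proof -
    define y where "y = map f (map \<xi> [0..<m])"
    have yj: "y ! j = f (\<xi> j)" if "j < m" for j using that by (simp add: y_def)
    obtain S b G where S: "S \<subseteq> Q" "card S \<le> v" and G: "integrable M G"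
      "\<And>x. x \<in> space M \<Longrightarrow> norm (f x - (\<Sum>k\<in>S. b k * \<psi> k x)) powr p \<le> G x" "(\<integral>x. G x \<partial>M) \<le> (10 * W) powr p"
      and mean: "(\<Sum>j<m. (norm (f (\<xi> j) - (\<Sum>k\<in>S. b k * \<psi> k (\<xi> j))))\<^sup>2) / real m \<le> (10 * W)\<^sup>2"
      using candidate[OF f] by blast
    have "good y S b" unfolding good_def using S mean yj by simp
    then have "good y (S\<^sub>M y) (b\<^sub>M y)" by (rule best)
    then have meanR: "(\<Sum>j<m. (norm (f (\<xi> j) - R y (\<xi> j)))\<^sup>2) / real m \<le> (10 * W)\<^sup>2"
      unfolding good_def R_def using yj by simp
    define D where "D x = (\<Sum>k\<in>S. b k * \<psi> k x) - R y x" for x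
    define T where "T = S \<union> S\<^sub>M y"
    define c where "c k = (if k \<in> S then b k else 0) - (if k \<in> S\<^sub>M y then b\<^sub>M y k else 0)" for k
    have fin: "finite S" "finite (S\<^sub>M y)" using S SM[of y] Q finite_subset by blast+
    have T: "T \<subseteq> Q" "card T \<le> 2 * v"
      using S SM[of y] card_Un_le[of S "S\<^sub>M y"] by (auto simp: T_def)
    have Dc: "D x = (\<Sum>k\<in>T. c k * \<psi> k x)" for x
    proof -
      have "(\<Sum>k\<in>T. c k * \<psi> k x) = (\<Sum>k\<in>T. (if k \<in> S then b k else 0) * \<psi> k x) - (\<Sum>k\<in>T. (if k \<in> S\<^sub>M y then b\<^sub>M y k else 0) * \<psi> k x)"
        unfolding c_def by (simp add: sum_subtractf left_diff_distrib)
      also have "(\<Sum>k\<in>T. (if k \<in> S then b k else 0) * \<psi> k x) = (\<Sum>k\<in>S. b k * \<psi> k x)"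
        unfolding T_def using fin by (intro sum.mono_neutral_cong_right) auto
      also have "(\<Sum>k\<in>T. (if k \<in> S\<^sub>M y then b\<^sub>M y k else 0) * \<psi> k x) = R y x"
        unfolding T_def R_def using fin by (intro sum.mono_neutral_cong_right) auto
      finally show ?thesis by (simp add: D_def)
    qed
    have Dmean: "(\<Sum>j<m. (norm (D (\<xi> j)))\<^sup>2) / real m \<le> 400 * W\<^sup>2"
    proof -
      have pw: "(norm (D x))\<^sup>2 \<le> 2 * (norm (f x - (\<Sum>k\<in>S. b k * \<psi> k x)))\<^sup>2 + 2 * (norm (f x - R y x))\<^sup>2" for x
      proof -
        have "D x = (f x - R y x) - (f x - (\<Sum>k\<in>S. b k * \<psi> k x))" by (simp add: D_def)
        then have "norm (D x) \<le> norm (f x - R y x) + norm (f x - (\<Sum>k\<in>S. b k * \<psi> k x))"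
          by (simp only: norm_triangle_ineq4)
        then have "(norm (D x))\<^sup>2 \<le> (norm (f x - R y x) + norm (f x - (\<Sum>k\<in>S. b k * \<psi> k x)))\<^sup>2"
          by (intro power_mono) auto
        also have "\<dots> \<le> 2 * (norm (f x - (\<Sum>k\<in>S. b k * \<psi> k x)))\<^sup>2 + 2 * (norm (f x - R y x))\<^sup>2"
          using sum_squares_bound[of "norm (f x - R y x)" "norm (f x - (\<Sum>k\<in>S. b k * \<psi> k x))"]
          by (simp add: power2_sum)
        finally show ?thesis .
      qed
      have "(\<Sum>j<m. (norm (D (\<xi> j)))\<^sup>2) / real m
        \<le> (\<Sum>j<m. 2 * (norm (f (\<xi> j) - (\<Sum>k\<in>S. b k * \<psi> k (\<xi> j))))\<^sup>2 + 2 * (norm (f (\<xi> j) - R y (\<xi> j)))\<^sup>2) / real m"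
        by (intro divide_right_mono sum_mono pw) auto
      also have "\<dots> = 2 * ((\<Sum>j<m. (norm (f (\<xi> j) - (\<Sum>k\<in>S. b k * \<psi> k (\<xi> j))))\<^sup>2) / real m)
          + 2 * ((\<Sum>j<m. (norm (f (\<xi> j) - R y (\<xi> j)))\<^sup>2) / real m)"
        by (simp only: sum.distrib sum_distrib_left[symmetric] add_divide_distrib times_divide_eq_right)
      also have "\<dots> \<le> 2 * (10 * W)\<^sup>2 + 2 * (10 * W)\<^sup>2" using mean meanR by linarith
      finally show ?thesis by (simp add: power_mult_distrib)
    qed
    \<comment> \<open>One factor 400 is the discretization constant, the other is 2 * 100 + 2 * 100
      from the two misfits.\<close>
    have D2: "(\<integral>x. (norm (D x))\<^sup>2 \<partial>M) \<le> (400 * W)\<^sup>2"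
      using discr[OF T, of c] Dmean unfolding Dc[symmetric] by (simp add: power_mult_distrib)
    have "Lp_norm M 2 D \<le> 400 * W"
    proof -
      have sq: "norm (D x) powr 2 = (norm (D x))\<^sup>2" for x by (cases "D x = 0") simp_all
      have "Lp_norm M 2 D = sqrt (\<integral>x. (norm (D x))\<^sup>2 \<partial>M)"
        unfolding Lp_norm_def sq by (intro powr_half_sqrt Bochner_Integration.integral_nonneg) simp
      also have "\<dots> \<le> sqrt ((400 * W)\<^sup>2)" by (rule real_sqrt_le_mono[OF D2])
      finally show ?thesis using W unfolding real_sqrt_abs by simp
    qed
    then have "H * Lp_norm M 2 D \<le> H * (400 * W)" using H by (intro mult_left_mono) auto
    then have Dp: "Lp_norm M p D \<le> 400 * (H * W)"
      using nikolskii[OF T, of c] unfolding Dc[symmetric] by simp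
    have Dint: "integrable M (\<lambda>x. norm (D x) powr p)"
      unfolding Dc by (rule comb_int[OF T(1)])
    have HW: "0 \<le> H * W" using H W by simp
    have "Lp_norm M p (\<lambda>x. f x - R y x) \<le> 1600 * (H * W)"
    proof (rule Lp_norm_le)
      show "integrable M (\<lambda>x. 2 powr p * (G x + norm (D x) powr p))" using G Dint by simp
      fix x assume x: "x \<in> space M"
      have "norm (f x - R y x) \<le> norm (f x - (\<Sum>k\<in>S. b k * \<psi> k x)) + norm (D x)"
        using norm_triangle_ineq[of "f x - (\<Sum>k\<in>S. b k * \<psi> k x)" "D x"] by (simp add: D_def)
      then have "norm (f x - R y x) powr p \<le> (norm (f x - (\<Sum>k\<in>S. b k * \<psi> k x)) + norm (D x)) powr p"
        using p by (intro powr_mono2) auto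
      also have "\<dots> \<le> 2 powr p * (norm (f x - (\<Sum>k\<in>S. b k * \<psi> k x)) powr p + norm (D x) powr p)"
        using p by (intro add_powr_le) auto
      also have "\<dots> \<le> 2 powr p * (G x + norm (D x) powr p)"
        using G(2)[OF x] by (intro mult_left_mono add_right_mono) auto
      finally show "norm (f x - R y x) powr p \<le> 2 powr p * (G x + norm (D x) powr p)" .
    next
      have "(\<integral>x. norm (D x) powr p \<partial>M) \<le> (400 * (H * W)) powr p"
        unfolding Lp_norm_powr[symmetric, of p, OF less_le_trans[OF zero_less_numeral p]]
        using Dp p by (intro powr_mono2) (auto simp: Lp_norm_def)
      moreover have "(\<integral>x. G x \<partial>M) \<le> (400 * (H * W)) powr p"
      proof (rule order_trans[OF G(3)], rule powr_mono2)
        \<comment> \<open>The candidate's own error carries no factor H; the lower bound on H lets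
          it be charged to H * W.\<close>
        have "W \<le> 2 * H * W" using H W mult_right_mono[of 1 "2 * H" W] by simp
        then show "10 * W \<le> 400 * (H * W)" using W by simp
      qed (use p W in auto)
      ultimately have "(\<integral>x. 2 powr p * (G x + norm (D x) powr p) \<partial>M) \<le> 2 powr p * (2 * (400 * (H * W)) powr p)"
        using G Dint by simp
      \<comment> \<open>Adding two equal bounds costs 2 <= 2 powr p, the triangle inequality another
        2 powr p, so 400 becomes 1600.\<close>
      also have "\<dots> \<le> 2 powr p * (2 powr p * (400 * (H * W)) powr p)"
        using powr_mono[of 1 p "2::real"] p by (intro mult_left_mono mult_right_mono) auto
      also have "\<dots> = (1600 * (H * W)) powr p" by (simp add: powr_mult[symmetric])
      finally show "(\<integral>x. 2 powr p * (G x + norm (D x) powr p) \<partial>M) \<le> (1600 * (H * W)) powr p" .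
    qed (use p HW in auto)
    then show ?thesis by (simp add: y_def mult.assoc)
  qed
  show ?thesis
    unfolding optimal_recovery_def
  proof (rule INF_lower2)
    show "map \<xi> [0..<m] \<in> {\<xi>. length \<xi> = m \<and> set \<xi> \<subseteq> space M}" using \<xi> by auto
    show "(INF M'\<in>{M' :: complex list \<Rightarrow> 'a \<Rightarrow> complex. \<forall>y. in_Lp M p (M' y)}.
          SUP f\<in>F. ereal (Lp_norm M p (\<lambda>x. f x - M' (map f (map \<xi> [0..<m])) x))) \<le> ereal (1600 * H * W)"
    proof (rule INF_lower2)
      show "R \<in> {M' :: complex list \<Rightarrow> 'a \<Rightarrow> complex. \<forall>y. in_Lp M p (M' y)}" using R_Lp by simp
      show "(SUP f\<in>F. ereal (Lp_norm M p (\<lambda>x. f x - R (map f (map \<xi> [0..<m])) x))) \<le> ereal (1600 * H * W)"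
        using err by (intro SUP_least) (simp del: map_map)
    qed
  qed
qed

text \<open>The zero map, used for the bounded range of v in which the target rate is bounded
  below.\<close>

lemma optimal_recovery_le_trivial:
  fixes F :: "('a \<Rightarrow> complex) set"
  assumes M: "prob_space M" and p: "0 < p" and B: "0 \<le> B"
    and F: "\<And>f x. f \<in> F \<Longrightarrow> x \<in> space M \<Longrightarrow> norm (f x) \<le> B"
  shows "optimal_recovery (space M) M p m F \<le> ereal B"
proof -
  interpret prob_space M by (rule M)
  obtain \<omega> where \<omega>: "\<omega> \<in> space M" using not_empty by blast
  have err: "Lp_norm M p (\<lambda>x. f x - 0) \<le> B" if "f \<in> F" for f
  proof (rule Lp_norm_le[OF p])
    show "norm (f x - 0) powr p \<le> B powr p" if "x \<in> space M" for x
      using F[OF \<open>f \<in> F\<close> that] p by (intro powr_mono2) auto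
  qed (use B in \<open>simp_all add: prob_space\<close>)
  show ?thesis
    unfolding optimal_recovery_def
  proof (rule INF_lower2)
    show "replicate m \<omega> \<in> {\<xi>. length \<xi> = m \<and> set \<xi> \<subseteq> space M}" using \<omega> by auto
    show "(INF M'\<in>{M' :: complex list \<Rightarrow> 'a \<Rightarrow> complex. \<forall>y. in_Lp M p (M' y)}.
          SUP f\<in>F. ereal (Lp_norm M p (\<lambda>x. f x - M' (map f (replicate m \<omega>)) x))) \<le> ereal B"
    proof (rule INF_lower2)
      show "(\<lambda>y x. 0) \<in> {M' :: complex list \<Rightarrow> 'a \<Rightarrow> complex. \<forall>y. in_Lp M p (M' y)}"
        using p by (simp add: in_Lp_def)
      show "(SUP f\<in>F. ereal (Lp_norm M p (\<lambda>x. f x - (\<lambda>y x. 0) (map f (replicate m \<omega>)) x))) \<le> ereal B"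
        using err by (intro SUP_least) simp
    qed
  qed
qed

section \<open>Choice of the parameters\<close>

lemma norm_infsum_diff_le:
  fixes a b :: "'i \<Rightarrow> complex"
  assumes a: "(\<lambda>k. norm (a k)) summable_on UNIV" and b: "\<And>k. norm (b k) \<le> 1" and Q: "finite Q"
    and tail: "\<And>F. finite F \<Longrightarrow> F \<inter> Q = {} \<Longrightarrow> (\<Sum>k\<in>F. norm (a k)) \<le> t"
  shows "norm ((\<Sum>\<^sub>\<infinity>k. a k * b k) - (\<Sum>k\<in>Q. a k * b k)) \<le> t"
proof -
  have le: "norm (a k * b k) \<le> norm (a k)" for k by (simp add: norm_mult b mult_left_le)
  have abs: "(\<lambda>k. norm (a k * b k)) summable_on UNIV"
    by (rule summable_on_comparison_test[OF a]) (use le in auto)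
  then have sum: "(\<lambda>k. a k * b k) summable_on UNIV" by (rule abs_summable_summable)
  have absQ: "(\<lambda>k. norm (a k * b k)) summable_on (- Q)"
    by (rule summable_on_subset_banach[OF abs]) simp
  have sumQ: "(\<lambda>k. a k * b k) summable_on (- Q)"
    by (rule summable_on_subset_banach[OF sum]) simp
  have "(\<Sum>\<^sub>\<infinity>k. a k * b k) = infsum (\<lambda>k. a k * b k) (Q \<union> - Q)" by simp
  also have "\<dots> = infsum (\<lambda>k. a k * b k) Q + infsum (\<lambda>k. a k * b k) (- Q)"
    using Q sumQ by (intro infsum_Un_disjoint) auto
  finally have "(\<Sum>\<^sub>\<infinity>k. a k * b k) - (\<Sum>k\<in>Q. a k * b k) = infsum (\<lambda>k. a k * b k) (- Q)"
    using Q by simp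
  then have "norm ((\<Sum>\<^sub>\<infinity>k. a k * b k) - (\<Sum>k\<in>Q. a k * b k)) \<le> (\<Sum>\<^sub>\<infinity>k\<in>- Q. norm (a k * b k))"
    using norm_infsum_bound[OF absQ] by simp
  also have "\<dots> \<le> t"
  proof (rule infsum_le_finite_sums[OF absQ])
    fix F assume F: "finite F" "F \<subseteq> - Q"
    have "(\<Sum>k\<in>F. norm (a k * b k)) \<le> (\<Sum>k\<in>F. norm (a k))" by (intro sum_mono le)
    also have "\<dots> \<le> t" using F by (intro tail) auto
    finally show "(\<Sum>k\<in>F. norm (a k * b k)) \<le> t" .
  qed
  finally show ?thesis .
qed

lemma exists_power_sandwich:
  fixes b x y :: real
  assumes b: "1 < b" and x: "0 < x" "x \<le> y"
  obtains n :: nat where "x * b ^ n \<le> y" "y < x * b ^ (n + 1)"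
proof -
  obtain k where "y / x < b ^ k" using real_arch_pow[OF b] by blast
  then have P: "y < x * b ^ k" using x by (simp add: field_simps)
  moreover have "\<not> y < x * b ^ 0" using x by simp
  ultimately obtain n where n: "\<forall>i<n. \<not> y < x * b ^ i" "y < x * b ^ n"
    using ex_least_nat_le[of "\<lambda>n. y < x * b ^ n" k] by blast
  then have "n \<noteq> 0" using x by (intro notI) simp
  then obtain n' where "n = n' + 1" using not0_implies_Suc by fastforce
  then show thesis using n that[of n'] by (simp add: not_less)
qed

text \<open>The upper bound on v, which is maximality of n, gives 2^(n+3) >= (v/4)^(1/d) and so
  converts the decay in n into v^(-r/d). Passing from n + 3 to n + 1 costs 4^r, and the 4 under v
  costs 4^(r/d).\<close>

lemma threshold_le:
  fixes r \<beta> q :: real and v n d :: nat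
  assumes \<beta>: "0 < \<beta>" and r: "0 < r" and q: "q < 1" and v: "0 < v" and d: "0 < d"
    and n: "real v < 4 * 2 ^ ((n + 3) * d)"
  shows "(real v * (1 - q) / 4) powr (- 1 / \<beta>) * 2 powr (- r * real (n + 1))
    \<le> (((1 - q) / 4) powr (- 1 / \<beta>) * 4 powr (r + r / d)) * real v powr (- (1 / \<beta> + r / d))"
proof -
  have "real v / 4 \<le> (2 powr real (n + 3)) powr real d"
    using n by (simp add: powr_powr powr_realpow[symmetric] del: of_nat_add)
  then have "(real v / 4) powr (1 / d) \<le> ((2 powr real (n + 3)) powr real d) powr (1 / d)"
    by (intro powr_mono2) auto
  then have "(real v / 4) powr (1 / d) \<le> 2 powr real (n + 3)" using d by (simp add: powr_powr)
  then have "(2 powr real (n + 3)) powr (- r) \<le> ((real v / 4) powr (1 / d)) powr (- r)"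
    using r v by (intro powr_mono2') auto
  also have "\<dots> = real v powr (- r / d) * (1 / 4) powr (- r / d)"
    using powr_mult[of "real v" "1 / 4" "- r / d"] by (simp add: powr_powr)
  also have "(1 / 4) powr (- r / d) = 4 powr (r / d)" by (simp add: powr_minus_divide powr_divide)
  finally have le: "4 powr r * (2 powr real (n + 3)) powr (- r) \<le> 4 powr r * (real v powr (- r / d) * 4 powr (r / d))"
    by (intro mult_left_mono) auto
  have eq: "4 powr r * (2 powr real (n + 3)) powr (- r) = 2 powr (- r * real (n + 1))"
  proof -
    have "4 powr r = (2 powr 2) powr r" by simp
    also have "\<dots> = 2 powr (2 * r)" by (rule powr_powr)
    finally show ?thesis by (simp add: powr_powr powr_add[symmetric] algebra_simps)
  qed
  have 2: "2 powr (- r * real (n + 1)) \<le> 4 powr (r + r / d) * real v powr (- r / d)"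
    using le unfolding eq by (simp only: powr_add mult_ac)
  have 1: "(real v * (1 - q) / 4) powr (- 1 / \<beta>) = real v powr (- 1 / \<beta>) * ((1 - q) / 4) powr (- 1 / \<beta>)"
    using powr_mult[of "real v" "(1 - q) / 4" "- 1 / \<beta>"] by simp
  have "(real v * (1 - q) / 4) powr (- 1 / \<beta>) * 2 powr (- r * real (n + 1))
     \<le> (real v powr (- 1 / \<beta>) * ((1 - q) / 4) powr (- 1 / \<beta>)) * (4 powr (r + r / d) * real v powr (- r / d))"
    unfolding 1 using 2 by (intro mult_left_mono) auto
  also have "\<dots> = (((1 - q) / 4) powr (- 1 / \<beta>) * 4 powr (r + r / d)) * (real v powr (- 1 / \<beta>) * real v powr (- r / d))"
    by (simp only: mult_ac)
  also have "real v powr (- 1 / \<beta>) * real v powr (- r / d) = real v powr (- (1 / \<beta> + r / d))"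
    unfolding powr_add[symmetric] by simp
  finally show ?thesis .
qed

text \<open>8 v K is A^2 for sparsity 2 v, and N stands for the size of a cube with exponent
  logarithmic in v. Then L and both logarithms are each at most a constant times ln (2 v); additive
  constants are absorbed because v >= 2 makes ln (2 v) at least 1.\<close>

lemma sampling_budget:
  fixes K \<eta> :: real and d :: nat
  assumes K: "1 \<le> K" and \<eta>: "0 \<le> \<eta>"
  shows "\<exists>c>0. \<forall>v m. 2 \<le> v \<and> c * real v * ln (2 * real v) ^ 4 \<le> real m \<longrightarrow>
    (\<exists>L. 2 * sqrt (8 * real v * K) < 2 ^ L \<and>
      (\<forall>N. 1 \<le> N \<and> N \<le> 2 ^ ((nat \<lceil>\<eta> * log 2 (real v)\<rceil> + 1) * d) \<longrightarrow>
        300000 * real L * (8 * real v * K) * ln (2048 * real L * (8 * real v * K)) * ln (5 * N) \<le> real m))"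
proof -
  define cL where "cL = 2 * (1 + ln (8 * K))"
  define c\<Lambda> where "c\<Lambda> = 2 * (1 + ln (256 * K))"
  define cN where "cN = 3 + (2 * \<eta> + 2) * real d"
  define c where "c = 300000 * cL * (8 * K) * c\<Lambda> * cN"
  have pos: "0 < cL" "0 < c\<Lambda>" "0 < cN"
    using K \<eta> by (auto simp: cL_def c\<Lambda>_def cN_def intro!: add_pos_nonneg)
  then have c0: "0 < c" using K by (simp add: c_def)
  have "\<exists>L. 2 * sqrt (8 * real v * K) < 2 ^ L \<and>
      (\<forall>N. 1 \<le> N \<and> N \<le> 2 ^ ((nat \<lceil>\<eta> * log 2 (real v)\<rceil> + 1) * d) \<longrightarrow>
        300000 * real L * (8 * real v * K) * ln (2048 * real L * (8 * real v * K)) * ln (5 * N) \<le> real m)"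
    if v: "2 \<le> v" and m: "c * real v * ln (2 * real v) ^ 4 \<le> real m" for v m :: nat
  proof -
    define y where "y = ln (2 * real v)"
    have e4: "exp 1 \<le> (4::real)" using exp_le by linarith
    have y1: "1 \<le> y" unfolding y_def using v e4 by (subst ln_ge_iff) auto
    define x where "x = real v * K"
    have x1: "1 \<le> x" unfolding x_def using v K mult_mono[of 1 "real v" 1 K] by simp
    have sq: "sqrt (8 * x) \<le> 4 * x"
    proof (rule real_le_lsqrt)
      have "8 * x * 1 \<le> 16 * x * x" using x1 by (intro mult_mono) auto
      then show "8 * x \<le> (4 * x)\<^sup>2" by (simp add: power2_eq_square)
    qed (use x1 in auto)
    have "1 \<le> sqrt (8 * x)" using x1 by simp
    then have base: "1 \<le> 2 * sqrt (8 * x)" by linarith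
    obtain L0 where L0: "1 * 2 ^ L0 \<le> 2 * sqrt (8 * x)" "2 * sqrt (8 * x) < 1 * 2 ^ (L0 + 1)"
      by (rule exists_power_sandwich[OF _ _ base, of 2]) (simp, simp, rule that)
    define L where "L = L0 + 1"
    have L: "2 * sqrt (8 * x) < 2 ^ L" "2 ^ L \<le> 16 * x" using L0 sq by (auto simp: L_def)
    have lnx: "ln (2 * b * x) = y + ln (b * K)" if "0 < b" for b
      using that v K unfolding y_def x_def by (simp add: ln_mult)
    have lnx_le: "ln (2 * b * x) \<le> (1 + ln (b * K)) * y" if "1 \<le> b" for b
    proof -
      have "1 \<le> b * K" using that K mult_mono[of 1 b 1 K] by simp
      then have "0 \<le> ln (b * K)" by simp
      then have "ln (b * K) * 1 \<le> ln (b * K) * y" using y1 by (intro mult_left_mono) auto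
      then show ?thesis using lnx[of b] that by (simp add: distrib_right)
    qed
    have Lle: "real L \<le> cL * y"
    proof -
      have "real L * ln 2 = ln (2 ^ L)" by (simp add: ln_realpow)
      also have "\<dots> \<le> ln (2 * 8 * x)" using L x1 by (subst ln_le_cancel_iff) auto
      also have "\<dots> \<le> (1 + ln (8 * K)) * y" by (rule lnx_le) simp
      finally have "real L * ln 2 \<le> (1 + ln (8 * K)) * y" .
      moreover have "real L * (1 / 2) \<le> real L * ln 2"
        using ln2_ge_two_thirds by (intro mult_left_mono) auto
      ultimately have "real L \<le> 2 * ((1 + ln (8 * K)) * y)" by linarith
      then show ?thesis by (simp only: cL_def mult.assoc)
    qed
    have Lpos: "1 \<le> real L" by (simp add: L_def)
    have Lx: "1 \<le> real L * x" using mult_mono[OF Lpos x1] by simp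
    have \<Lambda>le: "ln (2048 * real L * (8 * x)) \<le> c\<Lambda> * y"
    proof -
      have "real L \<le> 2 ^ L" by (rule of_nat_less_two_power[THEN less_imp_le])
      then have "real L \<le> 16 * x" using L by linarith
      then have "2048 * real L * (8 * x) \<le> 2048 * (16 * x) * (8 * x)"
        using x1 by (intro mult_right_mono mult_left_mono) auto
      also have "\<dots> = (2 * 256 * x)\<^sup>2" by (simp add: power2_eq_square)
      finally have "ln (2048 * real L * (8 * x)) \<le> ln ((2 * 256 * x)\<^sup>2)"
        using Lx x1 Lpos by (subst ln_le_cancel_iff) auto
      also have "\<dots> = 2 * ln (2 * 256 * x)" using x1 by (subst ln_realpow) auto
      also have "\<dots> \<le> 2 * ((1 + ln (256 * K)) * y)" using lnx_le[of 256] by simp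
      finally show ?thesis by (simp only: c\<Lambda>_def mult.assoc)
    qed
    have \<Lambda>0: "0 \<le> ln (2048 * real L * (8 * x))" using Lx by (intro ln_ge_zero) simp
    have "300000 * real L * (8 * x) * ln (2048 * real L * (8 * x)) * ln (5 * N) \<le> real m"
      if N: "1 \<le> N" "N \<le> 2 ^ ((nat \<lceil>\<eta> * log 2 (real v)\<rceil> + 1) * d)" for N :: real
    proof -
      define J where "J = nat \<lceil>\<eta> * log 2 (real v)\<rceil>"
      have lv: "0 \<le> log 2 (real v)" "log 2 (real v) \<le> 2 * y"
      proof -
        show "0 \<le> log 2 (real v)" using v by simp
        have "log 2 (real v) * (1 / 2) \<le> log 2 (real v) * ln 2"
          using ln2_ge_two_thirds \<open>0 \<le> log 2 (real v)\<close> by (intro mult_left_mono) auto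
        also have "\<dots> = ln (real v)" by (simp add: log_def)
        also have "\<dots> \<le> y" unfolding y_def using v by simp
        finally show "log 2 (real v) \<le> 2 * y" by simp
      qed
      have "0 \<le> \<eta> * log 2 (real v)" using \<eta> lv by simp
      then have "real J \<le> \<eta> * log 2 (real v) + 1" unfolding J_def by linarith
      also have "\<dots> \<le> \<eta> * (2 * y) + 1" using \<eta> lv by (intro add_right_mono mult_left_mono) auto
      finally have J: "real J + 1 \<le> (2 * \<eta> + 2) * y" using y1 by (simp add: algebra_simps)
      have "5 * N \<le> 2 ^ 3 * 2 ^ ((J + 1) * d)" using N unfolding J_def by (intro mult_mono) auto
      then have "5 * N \<le> 2 ^ (3 + (J + 1) * d)" by (simp only: power_add)
      then have "ln (5 * N) \<le> ln (2 ^ (3 + (J + 1) * d))" using N by (subst ln_le_cancel_iff) auto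
      also have "\<dots> = real (3 + (J + 1) * d) * ln 2" by (rule ln_realpow)
      also have "\<dots> \<le> real (3 + (J + 1) * d) * 1" using ln_2_less_1 by (intro mult_left_mono) auto
      also have "\<dots> = 3 * 1 + (real J + 1) * real d" by (simp add: distrib_right)
      also have "\<dots> \<le> 3 * y + ((2 * \<eta> + 2) * y) * real d" using J y1 by (intro add_mono mult_left_mono mult_right_mono) auto
      finally have Nle: "ln (5 * N) \<le> cN * y" by (simp add: cN_def algebra_simps)
      have N0: "0 \<le> ln (5 * N)" using N by simp
      have "300000 * real L * (8 * x) * ln (2048 * real L * (8 * x)) * ln (5 * N)
         \<le> 300000 * (cL * y) * (8 * x) * (c\<Lambda> * y) * (cN * y)"
        using Lle \<Lambda>le Nle \<Lambda>0 N0 pos x1 y1 by (intro mult_mono mult_left_mono mult_nonneg_nonneg) auto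
      also have "\<dots> = c * real v * y ^ 3" by (simp add: c_def x_def power3_eq_cube)
      \<comment> \<open>Three powers of the logarithm are what the argument consumes; the fourth is
        slack.\<close>
      also have "\<dots> \<le> c * real v * y ^ 4" using c0 y1 by (intro mult_left_mono power_increasing) auto
      also have "\<dots> \<le> real m" using m by (simp add: y_def)
      finally show ?thesis .
    qed
    then show ?thesis using L unfolding x_def by (intro exI[of _ L]) (auto simp: mult.assoc)
  qed
  then show ?thesis using c0 by (intro exI[of _ c]) auto
qed

text \<open>The Bessel inequality with one unit coefficient keeps the L_2 norm of
  \<open>\<psi> 0\<close> away from 0, so the Nikolskii inequality for this single function can be
  divided by it. The 1/2 comes from the constant in \<open>Lp_norm_ge_L2_norm\<close>.\<close>

lemma NI_imp_half_le:
  fixes \<mu> :: "(real ^ 'd) measure" and \<psi> :: "int ^ 'd \<Rightarrow> real ^ 'd \<Rightarrow> complex"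
  assumes M: "prob_space \<mu>" and meas: "\<psi> 0 \<in> borel_measurable \<mu>"
    and bessel: "unif_bounded_Bessel (space \<mu>) \<mu> \<psi> K" and p: "2 \<le> p"
    and NI: "NI \<mu> \<psi> p H u" "1 \<le> u"
  shows "1/2 \<le> H"
proof -
  interpret prob_space \<mu> by (rule M)
  have \<psi>: "norm (\<psi> 0 x) \<le> 1" if "x \<in> space \<mu>" for x using bessel that by (simp add: unif_bounded_Bessel_def)
  have "(\<Sum>k\<in>{0}. (norm ((\<lambda>_. 1) k :: complex))\<^sup>2) \<le> K * (\<integral>x. (norm (\<Sum>k\<in>{0}. (\<lambda>_. 1) k * \<psi> k x))\<^sup>2 \<partial>\<mu>)"
    using bessel[unfolded unif_bounded_Bessel_def, THEN conjunct2, rule_format, of "{0}" "\<lambda>_. 1"] by simp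
  then have "(\<integral>x. (norm (\<psi> 0 x))\<^sup>2 \<partial>\<mu>) \<noteq> 0" by auto
  moreover have sq: "(norm (\<psi> 0 x))\<^sup>2 = norm (\<psi> 0 x) powr 2" for x by (cases "\<psi> 0 x = 0") simp_all
  ultimately have pos: "0 < Lp_norm \<mu> 2 (\<psi> 0)" unfolding Lp_norm_def sq by simp
  have "Lp_norm \<mu> p (\<lambda>x. \<Sum>k\<in>{0}. (\<lambda>_. 1) k * \<psi> k x) \<le> H * Lp_norm \<mu> 2 (\<lambda>x. \<Sum>k\<in>{0}. (\<lambda>_. 1) k * \<psi> k x)"
    using NI(1)[unfolded NI_def, rule_format, of "{0}" "\<lambda>_. 1"] NI(2) by simp
  then have "Lp_norm \<mu> p (\<psi> 0) \<le> H * Lp_norm \<mu> 2 (\<psi> 0)" by simp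
  moreover have "Lp_norm \<mu> 2 (\<psi> 0) \<le> 2 * Lp_norm \<mu> p (\<psi> 0)" by (rule Lp_norm_ge_L2_norm[OF meas \<psi> p])
  ultimately have "1 * Lp_norm \<mu> 2 (\<psi> 0) \<le> (2 * H) * Lp_norm \<mu> 2 (\<psi> 0)" by simp
  then have "1 \<le> 2 * H" using pos by (simp only: mult_le_cancel_right_pos)
  then show ?thesis by simp
qed

theorem theorem5p5:
  fixes r \<beta> p :: real
  assumes "2 \<le> p" and "0 < \<beta>" and "\<beta> \<le> 1" and "0 < r"
  shows "\<exists>C>0. \<forall>K>0. \<exists>c>0.
    \<forall>(\<Omega> :: (real ^ 'd) set) (\<mu> :: (real ^ 'd) measure) (\<psi> :: int ^ 'd \<Rightarrow> real ^ 'd \<Rightarrow> complex).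
      compact \<Omega> \<and> prob_space \<mu> \<and> space \<mu> = \<Omega> \<and> sets \<mu> = sets (restrict_space borel \<Omega>) \<and>
      (\<forall>k. continuous_on \<Omega> (\<psi> k)) \<and> unif_bounded_Bessel \<Omega> \<mu> \<psi> K \<longrightarrow>
      (\<forall>(v::nat) (H::real) (m::nat). 1 \<le> v \<and> NI \<mu> \<psi> p H (2 * v) \<and>
          real m \<ge> c * real v * (ln (2 * real v)) ^ 4 \<longrightarrow>
        optimal_recovery \<Omega> \<mu> p m (A_class \<psi> r \<beta>)
          \<le> ereal (C * H * real v powr (1/2 - 1/\<beta> - r / real CARD('d))))"
proof -
  note p = assms(1) and \<beta> = assms(2,3) and r = assms(4)
  define d where "d = CARD('d)"
  have d0: "0 < d" by (simp add: d_def)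
  define \<gamma> where "\<gamma> = 1 / \<beta> + r / real d"
  have \<gamma>: "1 \<le> \<gamma>" using \<beta> r d0 by (simp add: \<gamma>_def add_increasing2)
  define q where "q = 2 powr (- r * \<beta>)"
  define \<rho> where "\<rho> = 2 powr (- r)"
  have q: "0 < q" "q < 1" and \<rho>: "0 < \<rho>" "\<rho> < 1" using r \<beta> by (auto simp: q_def \<rho>_def powr_less_one)
  \<comment> \<open>From this v on the block index n of \<open>large_coefficients\<close> exists, n
    = 0 being the first case.\<close>
  define V where "V = 4 * (2::real) ^ (2 * d)"
  have V: "4 \<le> V" by (simp add: V_def)
  define C1 where "C1 = ((1 - q) / 4) powr (- 1 / \<beta>) * 4 powr (r + r / d)"
  have C1: "0 < C1" using q by (simp add: C1_def)
  define C2 where "C2 = 7 * p * C1 + 1 / (1 - \<rho>)"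
  have C2: "0 < C2" unfolding C2_def using p C1 \<rho> by (intro add_pos_pos) auto
  define C0 where "C0 = 1 + 1 / (1 - \<rho>)"
  have C0: "0 < C0" unfolding C0_def using \<rho> by (intro add_pos_pos) auto
  \<comment> \<open>The first term serves v >= V. The second serves v < V, where 2 H >= 1 and
    v^(1/2-\<gamma>) >= V^(1/2-\<gamma>) compensate the trivial error C0.\<close>
  define C where "C = 1600 * C2 + 2 * C0 * V powr (\<gamma> - 1/2)"
  have C: "0 < C" unfolding C_def using C2 C0 by (intro add_pos_nonneg) auto
  \<comment> \<open>A cube of exponent \<eta> log2 v has 2^(-r J) <= v^(-\<gamma>), so its tail fits
    into the rate while J stays logarithmic.\<close>
  define \<eta> where "\<eta> = \<gamma> / r"
  have \<eta>: "0 \<le> \<eta>" using \<gamma> r by (simp add: \<eta>_def)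
  have "\<exists>c>0. \<forall>(\<Omega> :: (real ^ 'd) set) (\<mu> :: (real ^ 'd) measure) (\<psi> :: int ^ 'd \<Rightarrow> real ^ 'd \<Rightarrow> complex).
      compact \<Omega> \<and> prob_space \<mu> \<and> space \<mu> = \<Omega> \<and> sets \<mu> = sets (restrict_space borel \<Omega>) \<and>
      (\<forall>k. continuous_on \<Omega> (\<psi> k)) \<and> unif_bounded_Bessel \<Omega> \<mu> \<psi> K \<longrightarrow>
      (\<forall>(v::nat) (H::real) (m::nat). 1 \<le> v \<and> NI \<mu> \<psi> p H (2 * v) \<and>
          real m \<ge> c * real v * (ln (2 * real v)) ^ 4 \<longrightarrow>
        optimal_recovery \<Omega> \<mu> p m (A_class \<psi> r \<beta>)
          \<le> ereal (C * H * real v powr (1/2 - 1/\<beta> - r / real CARD('d))))" if "0 < K" for K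
  proof -
    \<comment> \<open>Enlarging K preserves the Bessel inequality and keeps the logarithms of the
      sampling budget nonnegative.\<close>
    define K1 where "K1 = max K 1"
    have K1: "1 \<le> K1" "K \<le> K1" by (auto simp: K1_def)
    obtain c where c: "0 < c" and budget: "\<And>v m. 2 \<le> v \<Longrightarrow> c * real v * ln (2 * real v) ^ 4 \<le> real m \<Longrightarrow>
      \<exists>L. 2 * sqrt (8 * real v * K1) < 2 ^ L \<and>
      (\<forall>N. 1 \<le> N \<and> N \<le> 2 ^ ((nat \<lceil>\<eta> * log 2 (real v)\<rceil> + 1) * d) \<longrightarrow>
        300000 * real L * (8 * real v * K1) * ln (2048 * real L * (8 * real v * K1)) * ln (5 * N) \<le> real m)"
      using sampling_budget[OF K1(1) \<eta>, of d] by blast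
    have main: "optimal_recovery (space \<mu>) \<mu> p m (A_class \<psi> r \<beta>) \<le> ereal (C * H * real v powr (1/2 - \<gamma>))"
      if M: "prob_space \<mu>" and sets: "sets \<mu> = sets (restrict_space borel (space \<mu>))"
        and cont: "\<And>k. continuous_on (space \<mu>) (\<psi> k)" and bessel: "unif_bounded_Bessel (space \<mu>) \<mu> \<psi> K"
        and v: "1 \<le> v" and NI: "NI \<mu> \<psi> p H (2 * v)" and m: "c * real v * (ln (2 * real v)) ^ 4 \<le> real m"
      for \<mu> :: "(real ^ 'd) measure" and \<psi> :: "int ^ 'd \<Rightarrow> real ^ 'd \<Rightarrow> complex" and v m :: nat and H :: real
    proof -
      have meas: "\<psi> k \<in> borel_measurable \<mu>" for k
        using borel_measurable_continuous_on_restrict[OF cont] measurable_cong_sets[OF sets refl] by blast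
      have \<psi>: "norm (\<psi> k x) \<le> 1" if "x \<in> space \<mu>" for k x
        using bessel that by (simp add: unif_bounded_Bessel_def)
      have H: "1/2 \<le> H" using NI_imp_half_le[OF M meas bessel p NI] v by simp
      have A_class_D: "\<exists>a. (\<lambda>k. norm (a k)) summable_on UNIV \<and> (\<forall>x. f x = (\<Sum>\<^sub>\<infinity>k. a k * \<psi> k x)) \<and>
        (\<forall>j::nat. (\<Sum>k\<in>dyadic_block j. (norm (a k)) powr \<beta>) powr (1 / \<beta>) \<le> 2 powr (- r * real j))"
        if "f \<in> A_class \<psi> r \<beta>" for f using that by (simp add: A_class_def)
      show ?thesis
      proof (cases "V \<le> real v")
        case False
        have "optimal_recovery (space \<mu>) \<mu> p m (A_class \<psi> r \<beta>) \<le> ereal C0"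
        proof (rule optimal_recovery_le_trivial[OF M])
          fix f x assume f: "f \<in> A_class \<psi> r \<beta>" and x: "x \<in> space \<mu>"
          obtain a where a: "(\<lambda>k. norm (a k)) summable_on UNIV" "\<And>x. f x = (\<Sum>\<^sub>\<infinity>k. a k * \<psi> k x)"
            "\<And>j::nat. (\<Sum>k\<in>dyadic_block j. (norm (a k)) powr \<beta>) powr (1 / \<beta>) \<le> 2 powr (- r * real j)"
            using A_class_D[OF f] by blast
          have "norm ((\<Sum>\<^sub>\<infinity>k. a k * \<psi> k x) - (\<Sum>k\<in>{}. a k * \<psi> k x)) \<le> C0"
            using \<psi>[OF x] l1_le[OF \<beta> r a(3)] by (intro norm_infsum_diff_le[OF a(1)]) (auto simp: C0_def \<rho>_def)
          then show "norm (f x) \<le> C0" by (simp add: a(2))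
        qed (use p C0 in auto)
        also have "C0 \<le> C * H * real v powr (1/2 - \<gamma>)"
        proof -
          have "V powr (1/2 - \<gamma>) \<le> real v powr (1/2 - \<gamma>)"
            using False v \<gamma> by (intro powr_mono2') auto
          then have "V powr (\<gamma> - 1/2) * V powr (1/2 - \<gamma>) \<le> V powr (\<gamma> - 1/2) * real v powr (1/2 - \<gamma>)"
            by (intro mult_left_mono) auto
          then have 1: "1 \<le> V powr (\<gamma> - 1/2) * real v powr (1/2 - \<gamma>)"
            unfolding powr_add[symmetric] using V by simp
          have "C0 * (1 * 1) \<le> C0 * ((2 * H) * (V powr (\<gamma> - 1/2) * real v powr (1/2 - \<gamma>)))"
            using H 1 C0 by (intro mult_left_mono mult_mono) auto
          also have "\<dots> = (2 * C0 * V powr (\<gamma> - 1/2)) * H * real v powr (1/2 - \<gamma>)" by (simp add: mult_ac)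
          also have "\<dots> \<le> C * H * real v powr (1/2 - \<gamma>)"
            unfolding C_def using H C2 by (intro mult_right_mono) auto
          finally show ?thesis by simp
        qed
        finally show ?thesis by simp
      next
        case True
        have v2: "2 \<le> v" using True V by linarith
        define J where "J = nat \<lceil>\<eta> * log 2 (real v)\<rceil>"
        define Q where "Q = (int_box J :: (int ^ 'd) set)"
        have finQ: "finite Q" unfolding Q_def by (rule finite_int_box)
        have Q0: "0 \<in> Q" by (simp add: Q_def int_box_def linf_int_def)
        then have neQ: "Q \<noteq> {}" by blast
        have m0: "0 < m"
        proof (rule ccontr)
          assume "\<not> 0 < m"
          moreover have "0 < c * real v * (ln (2 * real v)) ^ 4" using c v by simp
          ultimately show False using m by simp
        qed
        \<comment> \<open>The discretization is applied with sparsity 2 v, to differences of two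
          v-sparse polynomials: 8 v K1 = 4 * (2 v) * K1.\<close>
        define A where "A = sqrt (8 * real v * K1)"
        have "1 * 1 \<le> 8 * real v * K1" using v K1 by (intro mult_mono) auto
        then have A: "1 \<le> A" "A\<^sup>2 = 8 * real v * K1" using K1 by (auto simp: A_def)
        obtain L where L: "2 * A < 2 ^ L" and mL: "\<And>N. 1 \<le> N \<Longrightarrow> N \<le> 2 ^ ((J + 1) * d) \<Longrightarrow>
            300000 * real L * A\<^sup>2 * ln (2048 * real L * A\<^sup>2) * ln (5 * N) \<le> real m"
          using budget[OF v2 m] unfolding A(2) unfolding A_def J_def by blast
        have cardQ: "1 \<le> real (card Q)" "real (card Q) \<le> 2 ^ ((J + 1) * d)"
        proof -
          show "1 \<le> real (card Q)" using finQ neQ by (simp add: Suc_le_eq card_gt_0_iff)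
          have "real (card Q) \<le> real (2 ^ ((J + 1) * d))"
            unfolding Q_def d_def by (intro of_nat_mono card_int_box)
          then show "real (card Q) \<le> 2 ^ ((J + 1) * d)" by simp
        qed
        have bessel1: "(\<Sum>k\<in>S. (norm (a k))\<^sup>2) \<le> K1 * (\<integral>x. (norm (\<Sum>k\<in>S. a k * \<psi> k x))\<^sup>2 \<partial>\<mu>)"
          if "S \<subseteq> Q" for S a
        proof -
          have "(\<Sum>k\<in>S. (norm (a k))\<^sup>2) \<le> K * (\<integral>x. (norm (\<Sum>k\<in>S. a k * \<psi> k x))\<^sup>2 \<partial>\<mu>)"
            using bessel finite_subset[OF that finQ] unfolding unif_bounded_Bessel_def by blast
          also have "\<dots> \<le> K1 * (\<integral>x. (norm (\<Sum>k\<in>S. a k * \<psi> k x))\<^sup>2 \<partial>\<mu>)"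
            using K1 by (intro mult_right_mono Bochner_Integration.integral_nonneg) auto
          finally show ?thesis .
        qed
        have "\<exists>\<xi>. (\<forall>j<m. \<xi> j \<in> space \<mu>) \<and> (\<forall>S a. S \<subseteq> Q \<and> card S \<le> 2 * v \<longrightarrow>
           (\<integral>x. (norm (\<Sum>k\<in>S. a k * \<psi> k x))\<^sup>2 \<partial>\<mu>) \<le> 400 * ((\<Sum>j<m. (norm (\<Sum>k\<in>S. a k * \<psi> k (\<xi> j)))\<^sup>2) / real m))"
          by (rule sampling_discretization_sparse[OF M finQ neQ _ _ bessel1 _ A(1) _ L mL[OF cardQ]])
            (use \<psi> meas K1 A(2) in auto)
        then obtain \<xi> where \<xi>: "\<And>j. j < m \<Longrightarrow> \<xi> j \<in> space \<mu>"
          and discr: "\<And>S a. S \<subseteq> Q \<Longrightarrow> card S \<le> 2 * v \<Longrightarrow>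
           (\<integral>x. (norm (\<Sum>k\<in>S. a k * \<psi> k x))\<^sup>2 \<partial>\<mu>) \<le> 400 * ((\<Sum>j<m. (norm (\<Sum>k\<in>S. a k * \<psi> k (\<xi> j)))\<^sup>2) / real m)"
          by blast
        define W where "W = C2 * real v powr (1/2 - \<gamma>)"
        have W0: "0 \<le> W" using C2 by (simp add: W_def)
        \<comment> \<open>Bounds \<epsilon> v, twice the coefficient sum left after removing the
          large coefficients. Maurey's gain 1 / sqrt v then turns the exponent 1 - \<gamma> into 1/2
          - \<gamma>.\<close>
        define R where "R = C1 * real v powr (1 - \<gamma>)"
        have R0: "0 < R" using C1 v by (simp add: R_def)
        define t where "t = \<rho> ^ J / (1 - \<rho>)"
        have t0: "0 \<le> t" using \<rho> by (simp add: t_def)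
        have RtW: "7 * p * R / sqrt (real v) + t \<le> W"
        proof -
          have "real v powr (1 - \<gamma>) / sqrt (real v) = real v powr (1/2 - \<gamma>)"
            using v by (simp add: powr_half_sqrt[symmetric] powr_diff[symmetric])
          then have 1: "7 * p * R / sqrt (real v) = 7 * p * C1 * real v powr (1/2 - \<gamma>)"
            unfolding R_def by (metis mult.assoc times_divide_eq_right)
          have "\<rho> ^ J = 2 powr (- r * real J)" unfolding \<rho>_def by (rule powr_base_power[symmetric]) simp
          also have "\<dots> \<le> 2 powr (- r * (\<eta> * log 2 (real v)))"
          proof -
            have "\<eta> * log 2 (real v) \<le> real J" unfolding J_def by linarith
            then show ?thesis using r by simp
          qed
          also have "\<dots> = (2 powr (log 2 (real v))) powr (- \<gamma>)"
            using r by (simp add: powr_powr \<eta>_def mult.commute)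
          also have "\<dots> = real v powr (- \<gamma>)" using v by simp
          also have "\<dots> \<le> real v powr (1/2 - \<gamma>)" using v by (intro powr_mono) auto
          finally have "t \<le> real v powr (1/2 - \<gamma>) / (1 - \<rho>)" unfolding t_def using \<rho> by (intro divide_right_mono) auto
          then show ?thesis unfolding 1 W_def C2_def by (simp add: distrib_right)
        qed
        have n_ex: "\<exists>n. V * (2 ^ d) ^ n \<le> real v \<and> real v < V * (2 ^ d) ^ (n + 1)"
        proof -
          have "(1::real) < 2 ^ d" using d0 by simp
          then show ?thesis using exists_power_sandwich[of "2 ^ d" V "real v"] True V by (metis less_le_trans zero_less_numeral)
        qed
        then obtain n where n: "V * (2 ^ d) ^ n \<le> real v" "real v < V * (2 ^ d) ^ (n + 1)" by blast
        have n1: "4 * (2::real) ^ ((n + 2) * CARD('d)) \<le> real v"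
        proof -
          have "V * (2 ^ d) ^ n = 4 * (2 ^ (2 * d) * 2 ^ (d * n))" by (simp only: V_def power_mult mult.assoc)
          also have "\<dots> = 4 * 2 ^ ((n + 2) * d)" unfolding power_add[symmetric] by (simp add: algebra_simps)
          finally show ?thesis using n(1) by (simp add: d_def)
        qed
        have n2: "real v < 4 * 2 ^ ((n + 3) * d)"
        proof -
          have "V * (2 ^ d) ^ (n + 1) = 4 * (2 ^ (2 * d) * 2 ^ (d * (n + 1)))" by (simp only: V_def power_mult mult.assoc)
          also have "\<dots> = 4 * 2 ^ ((n + 3) * d)" unfolding power_add[symmetric] by (simp add: algebra_simps)
          finally show ?thesis using n(2) by simp
        qed
        have "optimal_recovery (space \<mu>) \<mu> p m (A_class \<psi> r \<beta>) \<le> ereal (1600 * H * W)"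
        proof (rule optimal_recovery_le_sparse[OF M finQ _ meas p H W0 \<xi> discr])
          fix S and b :: "int ^ 'd \<Rightarrow> complex" assume "S \<subseteq> Q" "card S \<le> 2 * v"
          then show "Lp_norm \<mu> p (\<lambda>x. \<Sum>k\<in>S. b k * \<psi> k x) \<le> H * Lp_norm \<mu> 2 (\<lambda>x. \<Sum>k\<in>S. b k * \<psi> k x)"
            using NI finite_subset[OF _ finQ] unfolding NI_def by blast
        next
          fix f assume f: "f \<in> A_class \<psi> r \<beta>"
          obtain a where a: "(\<lambda>k. norm (a k)) summable_on UNIV" "\<And>x. f x = (\<Sum>\<^sub>\<infinity>k. a k * \<psi> k x)"
            "\<And>j::nat. (\<Sum>k\<in>dyadic_block j. (norm (a k)) powr \<beta>) powr (1 / \<beta>) \<le> 2 powr (- r * real j)"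
            using A_class_D[OF f] by blast
          define \<epsilon> where "\<epsilon> = (real v * (1 - q) / 4) powr (- 1 / \<beta>) * 2 powr (- r * real (n + 1))"
          obtain S where S: "S \<subseteq> Q" "real (card S) \<le> real v / 2" "(\<Sum>k\<in>Q - S. norm (a k)) \<le> \<epsilon> * (real v / 2)"
            using large_coefficients[OF \<beta> r a(3) n1, of J] unfolding Q_def \<epsilon>_def q_def by blast
          have "\<epsilon> \<le> C1 * real v powr (- \<gamma>)"
            unfolding \<epsilon>_def C1_def \<gamma>_def using v by (intro threshold_le[OF \<beta>(1) r q(2) _ d0 n2]) auto
          then have "\<epsilon> * real v \<le> C1 * real v powr (- \<gamma>) * real v" by (intro mult_right_mono) auto
          also have "\<dots> = R" using v by (simp add: R_def powr_diff powr_minus field_simps)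
          finally have S3: "2 * (\<Sum>k\<in>Q - S. norm (a k)) \<le> R" using S(3) by simp
          show "\<exists>S b G. S \<subseteq> Q \<and> card S \<le> v \<and> integrable \<mu> G \<and>
            (\<forall>x\<in>space \<mu>. norm (f x - (\<Sum>k\<in>S. b k * \<psi> k x)) powr p \<le> G x) \<and>
            (\<integral>x. G x \<partial>\<mu>) \<le> (10 * W) powr p \<and>
            (\<Sum>j<m. (norm (f (\<xi> j) - (\<Sum>k\<in>S. b k * \<psi> k (\<xi> j))))\<^sup>2) / real m \<le> (10 * W)\<^sup>2"
          proof (rule sparse_candidate_exists[OF M finQ neQ _ meas p v2 S(1,2) R0 S3 \<xi> m0 _ t0 RtW])
            fix x assume x: "x \<in> space \<mu>"
            show "norm (f x - (\<Sum>k\<in>Q. a k * \<psi> k x)) \<le> t"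
              unfolding a(2) t_def \<rho>_def
              by (rule norm_infsum_diff_le[OF a(1) \<psi>[OF x] finQ]) (unfold Q_def, rule tail_l1_le[OF \<beta> r a(3)])
          qed (use \<psi> in auto)
        qed (use \<psi> in auto)
        also have "1600 * H * W \<le> C * H * real v powr (1/2 - \<gamma>)"
        proof -
          have "1600 * H * W = (1600 * C2) * H * real v powr (1/2 - \<gamma>)" by (simp add: W_def)
          also have "\<dots> \<le> C * H * real v powr (1/2 - \<gamma>)"
            unfolding C_def using H C0 by (intro mult_right_mono) auto
          finally show ?thesis .
        qed
        finally show ?thesis by simp
      qed
    qed
    have ex: "1/2 - \<gamma> = 1/2 - 1/\<beta> - r / real CARD('d)" by (simp add: \<gamma>_def d_def)
    show ?thesis
    proof (intro exI[of _ c] conjI c allI impI; elim conjE)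
      fix \<Omega> :: "(real ^ 'd) set" and \<mu> \<psi> v H m
      assume *: "prob_space \<mu>" "space \<mu> = \<Omega>" "sets \<mu> = sets (restrict_space borel \<Omega>)" "\<forall>k. continuous_on \<Omega> (\<psi> k)"
        "unif_bounded_Bessel \<Omega> \<mu> \<psi> K" "1 \<le> v" "NI \<mu> \<psi> p H (2 * v)" "c * real v * ln (2 * real v) ^ 4 \<le> real m"
      show "optimal_recovery \<Omega> \<mu> p m (A_class \<psi> r \<beta>) \<le> ereal (C * H * real v powr (1/2 - 1/\<beta> - r / real CARD('d)))"
        using main[of \<mu> \<psi> v H m] * unfolding ex by simp
    qed
  qed
  then show ?thesis using C by blast
qed

end
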